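(* If $G$ is a non-abelian finite group, then $\mathrm{AM}(\mathrm{ZA}(G))\ge\frac{2}{\sqrt3}$.
   Context: For a finite group $G$: $\widehat G$ is the set of equivalence classes of irreducible (unitary) representations, $d_\pi$ the dimension of $\pi$, $\chi_\pi$ its character. The central Fourier algebra $\mathrm{ZA}(G)$ is the algebra of class functions on $G$ under pointwise multiplication, with norm $\left\|\sum_{\pi\in\widehat G}\alpha_\pi\chi_\pi\right\|_{\mathrm A}=\sum_{\pi\in\widehat G}d_\pi|\alpha_\pi|$ (the norm inherited from the Fourier algebra $\mathrm{A}(G)$). For a Banach algebra $\mathcal{A}$ a bounded approximate diagonal (b.a.d.) is a bounded net $(d_\iota)$ in the projective tensor product $\mathcal{A}\hat\otimes\mathcal{A}$ such that for each $a\in\mathcal{A}$, $(a\otimes1)d_\iota-d_\iota(1\otimes a)\to0$ and $m(d_\iota)a\to a$, where $m:\mathcal{A}\hat\otimes\mathcal{A}\to\mathcal{A}$ is multiplication. The amenability constant is $\mathrm{AM}(\mathcal{A})=\inf\{M>0:\text{there is a b.a.d. }(d_\iota)\text{ for }\mathcal{A}\text{ with }\|d_\iota\|_{\mathcal{A}\hat\otimes\mathcal{A}}\le M\text{ for all }\iota\}$, with $\inf\varnothing=\infty$. *)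

theory Defs
  imports
    "Jordan_Normal_Form.Schur_Decomposition"
    "Jordan_Normal_Form.VS_Connect"
    "HOL-Library.Extended_Real"
begin

section \<open>Banach algebras and their projective tensor squares\<close>

record 'a normed_algebra = "(complex, 'a) module" +
  nrm :: "'a \<Rightarrow> real"

definition bounded_bilinear_forms ::
    "('a, 'm) normed_algebra_scheme \<Rightarrow> ('a \<Rightarrow> 'a \<Rightarrow> complex) set" where
  "bounded_bilinear_forms A = {\<phi>.
     (\<forall>x\<in>carrier A. \<forall>y\<in>carrier A. \<forall>z\<in>carrier A.
        \<phi> (x \<oplus>\<^bsub>A\<^esub> y) z = \<phi> x z + \<phi> y z \<and> \<phi> z (x \<oplus>\<^bsub>A\<^esub> y) = \<phi> z x + \<phi> z y) \<and>
     (\<forall>c. \<forall>x\<in>carrier A. \<forall>y\<in>carrier A.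
        \<phi> (c \<odot>\<^bsub>A\<^esub> x) y = c * \<phi> x y \<and> \<phi> x (c \<odot>\<^bsub>A\<^esub> y) = c * \<phi> x y) \<and>
     (\<exists>B. \<forall>x\<in>carrier A. \<forall>y\<in>carrier A. cmod (\<phi> x y) \<le> B * nrm A x * nrm A y)}"

text \<open>
  Elements of the projective tensor product of a Banach algebra \<open>A\<close> with itself are the sums of
  series \<open>\<Sum>n. a n \<otimes> b n\<close> with \<open>\<Sum>n. \<parallel>a n\<parallel> * \<parallel>b n\<parallel> < \<infinity>\<close>, the norm being the infimum of
  \<open>\<Sum>n. \<parallel>a n\<parallel> * \<parallel>b n\<parallel>\<close> over all such series for the given element. The dual space is the space of
  bounded bilinear forms, and we identify a tensor with the functional \<open>\<phi> \<mapsto> \<Sum>n. \<phi> (a n) (b n)\<close>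
  that it induces there; by Hahn-Banach, two series have the same sum iff they induce the same
  functional. Functionals are \<open>0\<close> outside the bounded bilinear forms.
\<close>

type_synonym 'a tensor = "('a \<Rightarrow> 'a \<Rightarrow> complex) \<Rightarrow> complex"

definition represents ::
    "('a, 'm) normed_algebra_scheme \<Rightarrow> (nat \<Rightarrow> 'a) \<Rightarrow> (nat \<Rightarrow> 'a) \<Rightarrow> 'a tensor \<Rightarrow> bool" where
  "represents A a b u \<longleftrightarrow>
     range a \<subseteq> carrier A \<and> range b \<subseteq> carrier A \<and>
     summable (\<lambda>n. nrm A (a n) * nrm A (b n)) \<and>
     u = (\<lambda>\<phi>. if \<phi> \<in> bounded_bilinear_forms A then \<Sum>n. \<phi> (a n) (b n) else 0)"

definition proj_tensor :: "('a, 'm) normed_algebra_scheme \<Rightarrow> 'a tensor set" where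
  "proj_tensor A = {u. \<exists>a b. represents A a b u}"

definition proj_norm :: "('a, 'm) normed_algebra_scheme \<Rightarrow> 'a tensor \<Rightarrow> real" where
  "proj_norm A u = Inf {(\<Sum>n. nrm A (a n) * nrm A (b n)) | a b. represents A a b u}"

text \<open>The products \<open>(c \<otimes> 1) u\<close> and \<open>u (1 \<otimes> c)\<close>, that is, the linear extensions of
  \<open>x \<otimes> y \<mapsto> c x \<otimes> y\<close> and \<open>x \<otimes> y \<mapsto> x \<otimes> y c\<close>; no unit of \<open>A\<close> is needed.\<close>

definition left_act :: "('a, 'm) normed_algebra_scheme \<Rightarrow> 'a \<Rightarrow> 'a tensor \<Rightarrow> 'a tensor" where
  "left_act A c u =
     (\<lambda>\<phi>. if \<phi> \<in> bounded_bilinear_forms A then u (\<lambda>x y. \<phi> (c \<otimes>\<^bsub>A\<^esub> x) y) else 0)"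

definition right_act :: "('a, 'm) normed_algebra_scheme \<Rightarrow> 'a tensor \<Rightarrow> 'a \<Rightarrow> 'a tensor" where
  "right_act A u c =
     (\<lambda>\<phi>. if \<phi> \<in> bounded_bilinear_forms A then u (\<lambda>x y. \<phi> x (y \<otimes>\<^bsub>A\<^esub> c)) else 0)"

text \<open>The multiplication map, \<open>\<Sum>n. a n \<otimes> b n \<mapsto> \<Sum>n. a n * b n\<close> (norm convergent).\<close>

definition mult_map :: "('a, 'm) normed_algebra_scheme \<Rightarrow> 'a tensor \<Rightarrow> 'a" where
  "mult_map A u = (THE c. c \<in> carrier A \<and> (\<exists>a b. represents A a b u \<and>
     (\<lambda>N. nrm A (c \<ominus>\<^bsub>A\<^esub> (\<Oplus>\<^bsub>A\<^esub>n\<in>{..<N}. a n \<otimes>\<^bsub>A\<^esub> b n))) \<longlonglongrightarrow> 0))"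


section \<open>Amenability constant\<close>

text \<open>A net in the projective tensor product is given by the filter generated by its tails. Every
  proper filter arises in this way, and boundedness and convergence of the net depend only on the
  filter.\<close>

definition tensor_bounded_by ::
    "('a, 'm) normed_algebra_scheme \<Rightarrow> 'a tensor filter \<Rightarrow> real \<Rightarrow> bool" where
  "tensor_bounded_by A F M \<longleftrightarrow> F \<le> principal {u \<in> proj_tensor A. proj_norm A u \<le> M}"

definition bounded_approximate_diagonal ::
    "('a, 'm) normed_algebra_scheme \<Rightarrow> 'a tensor filter \<Rightarrow> bool" where
  "bounded_approximate_diagonal A F \<longleftrightarrow>
     F \<noteq> bot \<and> (\<exists>M. tensor_bounded_by A F M) \<and>
     (\<forall>c\<in>carrier A.
        ((\<lambda>u. proj_norm A (\<lambda>\<phi>. left_act A c u \<phi> - right_act A u c \<phi>)) \<longlongrightarrow> 0) F \<and>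
        ((\<lambda>u. nrm A ((mult_map A u \<otimes>\<^bsub>A\<^esub> c) \<ominus>\<^bsub>A\<^esub> c)) \<longlongrightarrow> 0) F)"

definition amenability_constant :: "('a, 'm) normed_algebra_scheme \<Rightarrow> ereal" where
  "amenability_constant A = Inf {ereal M | M. M > 0 \<and>
     (\<exists>F. bounded_approximate_diagonal A F \<and> tensor_bounded_by A F M)}"


section \<open>Irreducible representations of a group\<close>

text \<open>Representations are matrix valued; the degree is read off from the image of the unit.\<close>

definition rep_degree :: "('g, 'm) monoid_scheme \<Rightarrow> ('g \<Rightarrow> complex mat) \<Rightarrow> nat" where
  "rep_degree G \<rho> = dim_row (\<rho> \<one>\<^bsub>G\<^esub>)"

definition unitary_rep :: "('g, 'm) monoid_scheme \<Rightarrow> ('g \<Rightarrow> complex mat) \<Rightarrow> bool" where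
  "unitary_rep G \<rho> \<longleftrightarrow>
     (\<forall>g\<in>carrier G. \<rho> g \<in> carrier_mat (rep_degree G \<rho>) (rep_degree G \<rho>) \<and>
        \<rho> g * mat_adjoint (\<rho> g) = 1\<^sub>m (rep_degree G \<rho>)) \<and>
     \<rho> \<one>\<^bsub>G\<^esub> = 1\<^sub>m (rep_degree G \<rho>) \<and>
     (\<forall>g\<in>carrier G. \<forall>h\<in>carrier G. \<rho> (g \<otimes>\<^bsub>G\<^esub> h) = \<rho> g * \<rho> h)"

definition irreducible_rep :: "('g, 'm) monoid_scheme \<Rightarrow> ('g \<Rightarrow> complex mat) \<Rightarrow> bool" where
  "irreducible_rep G \<rho> \<longleftrightarrow>
     unitary_rep G \<rho> \<and> rep_degree G \<rho> > 0 \<and>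
     (\<forall>W. VectorSpace.subspace class_ring W (module_vec TYPE(complex) (rep_degree G \<rho>)) \<and>
          (\<forall>g\<in>carrier G. \<forall>w\<in>W. \<rho> g *\<^sub>v w \<in> W)
        \<longrightarrow> W = {0\<^sub>v (rep_degree G \<rho>)} \<or> W = carrier_vec (rep_degree G \<rho>))"

definition rep_equivalence ::
    "('g, 'm) monoid_scheme \<Rightarrow> (('g \<Rightarrow> complex mat) \<times> ('g \<Rightarrow> complex mat)) set" where
  "rep_equivalence G = {(\<rho>, \<sigma>). irreducible_rep G \<rho> \<and> irreducible_rep G \<sigma> \<and>
     rep_degree G \<rho> = rep_degree G \<sigma> \<and>
     (\<exists>P \<in> carrier_mat (rep_degree G \<rho>) (rep_degree G \<rho>). invertible_mat P \<and>
        (\<forall>g\<in>carrier G. P * \<rho> g = \<sigma> g * P))}"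

definition unitary_dual :: "('g, 'm) monoid_scheme \<Rightarrow> ('g \<Rightarrow> complex mat) set set" where
  "unitary_dual G = {\<rho>. irreducible_rep G \<rho>} // rep_equivalence G"

text \<open>Degree and character do not depend on the representative. Functions on \<open>G\<close> are \<open>0\<close> outside
  the carrier, so that the vector space operations on them are pointwise.\<close>

definition degree_of :: "('g, 'm) monoid_scheme \<Rightarrow> ('g \<Rightarrow> complex mat) set \<Rightarrow> nat" where
  "degree_of G \<pi> = rep_degree G (SOME \<rho>. \<rho> \<in> \<pi>)"

definition character_of ::
    "('g, 'm) monoid_scheme \<Rightarrow> ('g \<Rightarrow> complex mat) set \<Rightarrow> 'g \<Rightarrow> complex" where
  "character_of G \<pi> g =
     (if g \<in> carrier G then \<Sum>i<degree_of G \<pi>. (SOME \<rho>. \<rho> \<in> \<pi>) g $$ (i, i) else 0)"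


section \<open>The central Fourier algebra of a finite group\<close>

definition class_functions :: "('g, 'm) monoid_scheme \<Rightarrow> ('g \<Rightarrow> complex) set" where
  "class_functions G = {f. (\<forall>g. g \<notin> carrier G \<longrightarrow> f g = 0) \<and>
     (\<forall>g\<in>carrier G. \<forall>h\<in>carrier G. f (h \<otimes>\<^bsub>G\<^esub> g \<otimes>\<^bsub>G\<^esub> inv\<^bsub>G\<^esub> h) = f g)}"

text \<open>The irreducible characters form a basis of the class functions, so the coefficients are
  unique.\<close>

definition fourier_norm :: "('g, 'm) monoid_scheme \<Rightarrow> ('g \<Rightarrow> complex) \<Rightarrow> real" where
  "fourier_norm G f = (THE r. \<exists>\<alpha>.
     f = (\<lambda>g. \<Sum>\<pi>\<in>unitary_dual G. \<alpha> \<pi> * character_of G \<pi> g) \<and>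
     r = (\<Sum>\<pi>\<in>unitary_dual G. real (degree_of G \<pi>) * cmod (\<alpha> \<pi>)))"

definition ZA :: "('g, 'm) monoid_scheme \<Rightarrow> ('g \<Rightarrow> complex) normed_algebra" where
  "ZA G = \<lparr>carrier = class_functions G,
     monoid.mult = (\<lambda>f h x. f x * h x),
     one = (\<lambda>x. if x \<in> carrier G then 1 else 0),
     zero = (\<lambda>x. 0),
     add = (\<lambda>f h x. f x + h x),
     module.smult = (\<lambda>c f x. c * f x),
     nrm = fourier_norm G\<rparr>"

end

theory Submission
  imports Defs "Jordan_Normal_Form.Spectral_Radius"
begin

text \<open>
  Choose \<open>x\<close> and \<open>k\<close> that do not commute and put \<open>y = k x k\<^sup>-\<^sup>1\<close>. A virtual diagonal of \<open>ZA G\<close> must be the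
  indicator function of the set \<open>D = {(g, h). g and h are conjugate}\<close>, regarded as an element of the
  Fourier algebra of \<open>G \<times> G\<close>. If \<open>D\<close> were a subgroup of \<open>G \<times> G\<close>, then \<open>(x, y) \<in> D\<close> and
  \<open>(x\<^sup>-\<^sup>1, x\<^sup>-\<^sup>1) \<in> D\<close> would give \<open>(1, y x\<^sup>-\<^sup>1) \<in> D\<close>, that is, \<open>y = x\<close>. So the matrix
  \<open>[1_D (s\<^sub>i\<^sup>-\<^sup>1 t\<^sub>j)]\<close> with \<open>s\<^sub>1 = t\<^sub>1 = (1, 1)\<close>, \<open>s\<^sub>2 = (x\<^sup>-\<^sup>1, y\<^sup>-\<^sup>1)\<close>, \<open>t\<^sub>2 = (x\<^sup>-\<^sup>1, x\<^sup>-\<^sup>1)\<close> is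
  \<open>[[1, 1], [1, 0]]\<close>, and the Schur multiplier norm of this matrix, which is \<open>2 / sqrt 3\<close>, is a lower
  bound for the norm of the diagonal.

  To make this concrete, pair the four matrix entries with the weights \<open>[[2, 2], [2, -1]]\<close>. The
  resulting bilinear form on \<open>ZA G\<close> (\<open>three_ones_form\<close>) has norm at most \<open>3 * sqrt 3\<close>
  (\<open>three_ones_form_bound\<close>), because for vectors of norm at most one the corresponding combination of
  four inner products has absolute value at most \<open>3 * sqrt 3\<close> (\<open>three_ones_inequality\<close>) and
  \<open>\<chi>\<^sub>\<pi> \<otimes> \<chi>\<^sub>\<sigma>\<close> is a sum of \<open>d\<^sub>\<pi> d\<^sub>\<sigma>\<close> diagonal coefficients of a unitary representation of \<open>G \<times> G\<close>.
  Along a bounded approximate diagonal the tensors tend, at every pair of points \<open>(g, h)\<close>, to the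
  value of \<open>1_D\<close> (\<open>approximate_diagonal_conjugate\<close>, \<open>approximate_diagonal_nonconjugate\<close>), so the
  form tends to \<open>2 + 2 + 2 - 0 = 6\<close>. Hence a bound \<open>M\<close> for the net satisfies \<open>6 \<le> 3 * sqrt 3 * M\<close>.

  All this needs the norm of \<open>ZA G\<close> to be what its definition suggests: the irreducible characters
  must form a basis of the class functions. Linear independence and finiteness of the dual come from
  Schur's lemma and the orthogonality relations. Spanning (\<open>class_function_zero\<close>) is obtained from a
  minimal translation invariant space of functions orthogonal to all coefficients of irreducible
  representations: it would carry an irreducible representation and lie in the span of the
  coefficients of that representation, hence be orthogonal to itself.
\<close>

section \<open>Orthonormal families of functions on a finite set\<close>

definition inner_on :: "'a set \<Rightarrow> ('a \<Rightarrow> complex) \<Rightarrow> ('a \<Rightarrow> complex) \<Rightarrow> complex" where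
  "inner_on X f h = (\<Sum>x\<in>X. f x * cnj (h x))"

definition orthonormal_on :: "'a set \<Rightarrow> 's set \<Rightarrow> ('s \<Rightarrow> 'a \<Rightarrow> complex) \<Rightarrow> bool" where
  "orthonormal_on X S e \<longleftrightarrow> (\<forall>s\<in>S. \<forall>t\<in>S. inner_on X (e s) (e t) = (if s = t then 1 else 0))"

definition linear_closed :: "('a \<Rightarrow> complex) set \<Rightarrow> bool" where
  "linear_closed V \<longleftrightarrow> (\<lambda>x. 0) \<in> V \<and> (\<forall>u\<in>V. \<forall>v\<in>V. (\<lambda>x. u x + v x) \<in> V) \<and>
     (\<forall>c. \<forall>v\<in>V. (\<lambda>x. c * v x) \<in> V)"

lemma inner_on_sum_left:
  "inner_on X (\<lambda>x. \<Sum>s\<in>S. c s * e s x) h = (\<Sum>s\<in>S. c s * inner_on X (e s) h)"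
proof -
  have "inner_on X (\<lambda>x. \<Sum>s\<in>S. c s * e s x) h = (\<Sum>x\<in>X. \<Sum>s\<in>S. c s * (e s x * cnj (h x)))"
    unfolding inner_on_def by (simp add: sum_distrib_right mult.assoc)
  also have "\<dots> = (\<Sum>s\<in>S. c s * inner_on X (e s) h)"
    unfolding inner_on_def by (subst sum.swap) (simp add: sum_distrib_left)
  finally show ?thesis .
qed

lemma inner_on_diff_left: "inner_on X (\<lambda>x. f x - g x) h = inner_on X f h - inner_on X g h"
  by (simp add: inner_on_def algebra_simps sum_subtractf)

lemma inner_on_add_left: "inner_on X (\<lambda>x. f x + g x) h = inner_on X f h + inner_on X g h"
  by (simp add: inner_on_def algebra_simps sum.distrib)

lemma inner_on_scale_left: "inner_on X (\<lambda>x. c * f x) h = c * inner_on X f h"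
  by (simp add: inner_on_def sum_distrib_left mult.assoc)

lemma inner_on_commute: "inner_on X f h = cnj (inner_on X h f)"
  by (simp add: inner_on_def mult.commute)

lemma inner_on_self: "inner_on X f f = of_real (\<Sum>x\<in>X. (cmod (f x))\<^sup>2)"
  by (simp add: inner_on_def complex_norm_square del: of_real_power)

lemma sum_norm_squares_eq_0D:
  fixes f :: "'a \<Rightarrow> complex"
  assumes "finite X" "(\<Sum>x\<in>X. (cmod (f x))\<^sup>2) = 0" "x \<in> X"
  shows "f x = 0"
  using assms by (simp add: sum_nonneg_eq_0_iff)

lemma inner_on_residual:
  assumes "finite S" "orthonormal_on X S e" "t \<in> S"
  shows "inner_on X (\<lambda>x. f x - (\<Sum>s\<in>S. inner_on X f (e s) * e s x)) (e t) = 0"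
proof -
  have "(\<Sum>s\<in>S. inner_on X f (e s) * inner_on X (e s) (e t)) =
        (\<Sum>s\<in>S. if s = t then inner_on X f (e s) else 0)"
    using assms by (intro sum.cong) (auto simp: orthonormal_on_def)
  also have "\<dots> = inner_on X f (e t)" using assms by simp
  finally show ?thesis by (simp add: inner_on_diff_left inner_on_sum_left)
qed

text \<open>The residual of the orthogonal projection is orthogonal to the family, so this is Pythagoras.\<close>

lemma bessel_identity:
  assumes "finite S" "orthonormal_on X S e"
  shows "(\<Sum>x\<in>X. (cmod (f x - (\<Sum>s\<in>S. inner_on X f (e s) * e s x)))\<^sup>2)
       = (\<Sum>x\<in>X. (cmod (f x))\<^sup>2) - (\<Sum>s\<in>S. (cmod (inner_on X f (e s)))\<^sup>2)"
proof -
  define p where "p = (\<lambda>x. \<Sum>s\<in>S. inner_on X f (e s) * e s x)"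
  define r where "r = (\<lambda>x. f x - p x)"
  have r: "inner_on X r (e t) = 0" if "t \<in> S" for t
    using inner_on_residual[OF assms that] by (simp add: r_def p_def)
  have "inner_on X p r = (\<Sum>s\<in>S. inner_on X f (e s) * inner_on X (e s) r)"
    unfolding p_def by (rule inner_on_sum_left)
  also have "\<dots> = 0" using r inner_on_commute[of X _ r] by simp
  finally have pr: "inner_on X p r = 0" .
  have "inner_on X p f = (\<Sum>s\<in>S. inner_on X f (e s) * inner_on X (e s) f)"
    unfolding p_def by (rule inner_on_sum_left)
  also have "\<dots> = of_real (\<Sum>s\<in>S. (cmod (inner_on X f (e s)))\<^sup>2)"
    by (simp add: complex_norm_square inner_on_commute[of X _ f] del: of_real_power)
  finally have pf: "inner_on X p f = of_real (\<Sum>s\<in>S. (cmod (inner_on X f (e s)))\<^sup>2)" .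
  have "inner_on X r r = inner_on X f r - inner_on X p r"
    unfolding r_def by (simp add: inner_on_diff_left)
  also have "\<dots> = cnj (inner_on X r f)" using pr inner_on_commute by simp
  also have "\<dots> = cnj (inner_on X f f - inner_on X p f)"
    unfolding r_def by (simp add: inner_on_diff_left)
  also have "\<dots> = of_real ((\<Sum>x\<in>X. (cmod (f x))\<^sup>2) - (\<Sum>s\<in>S. (cmod (inner_on X f (e s)))\<^sup>2))"
    by (simp add: pf inner_on_self)
  finally have "complex_of_real (\<Sum>x\<in>X. (cmod (r x))\<^sup>2) =
      of_real ((\<Sum>x\<in>X. (cmod (f x))\<^sup>2) - (\<Sum>s\<in>S. (cmod (inner_on X f (e s)))\<^sup>2))"
    unfolding inner_on_self[of X r] .
  then show ?thesis unfolding r_def p_def of_real_eq_iff .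
qed

lemma inner_on_indicator:
  assumes "finite X" "y \<in> X"
  shows "inner_on X (\<lambda>x. if x = y then 1 else 0) h = cnj (h y)"
proof -
  have "inner_on X (\<lambda>x. if x = y then 1 else 0) h = (\<Sum>x\<in>X. if x = y then cnj (h x) else 0)"
    unfolding inner_on_def by (intro sum.cong) auto
  with assms show ?thesis by simp
qed

text \<open>Bessel's identity for a point mass. Its case of equality is what detects a complete family.\<close>

lemma bessel_at_point:
  assumes "finite X" "finite S" "orthonormal_on X S e" "y \<in> X"
  shows "(\<Sum>x\<in>X. (cmod ((if x = y then 1 else 0) - (\<Sum>s\<in>S. cnj (e s y) * e s x)))\<^sup>2)
       = 1 - (\<Sum>s\<in>S. (cmod (e s y))\<^sup>2)"
proof -
  have "(\<Sum>x\<in>X. (cmod (if x = y then 1 else 0))\<^sup>2) = (\<Sum>x\<in>X. if x = y then 1 else (0::real))"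
    by (intro sum.cong) auto
  also have "\<dots> = 1" using assms(1,4) by simp
  finally have "(\<Sum>x\<in>X. (cmod (if x = y then 1 else 0))\<^sup>2) = 1" .
  then show ?thesis
    using bessel_identity[OF assms(2,3), of "\<lambda>x. if x = y then 1 else 0"]
    by (simp only: inner_on_indicator[OF assms(1,4)] complex_mod_cnj)
qed

lemma bessel_at_point_le:
  assumes "finite X" "finite S" "orthonormal_on X S e" "y \<in> X"
  shows "(\<Sum>s\<in>S. (cmod (e s y))\<^sup>2) \<le> 1"
proof -
  have "0 \<le> (\<Sum>x\<in>X. (cmod ((if x = y then 1 else 0) - (\<Sum>s\<in>S. cnj (e s y) * e s x)))\<^sup>2)"
    by (intro sum_nonneg) simp
  then show ?thesis unfolding bessel_at_point[OF assms] by simp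
qed

lemma orthonormal_sum_squares:
  assumes "orthonormal_on X S e"
  shows "(\<Sum>y\<in>X. \<Sum>s\<in>S. (cmod (e s y))\<^sup>2) = real (card S)"
proof -
  have "(\<Sum>y\<in>X. (cmod (e s y))\<^sup>2) = 1" if "s \<in> S" for s
  proof -
    have "complex_of_real (\<Sum>y\<in>X. (cmod (e s y))\<^sup>2) = 1"
      using assms that inner_on_self[of X "e s"] by (simp add: orthonormal_on_def)
    then show ?thesis by (simp only: of_real_eq_1_iff)
  qed
  then show ?thesis by (subst sum.swap) simp
qed

text \<open>Sum Bessel's inequality at a point over all points.\<close>

lemma orthonormal_card_le:
  assumes "finite X" "finite S" "orthonormal_on X S e"
  shows "card S \<le> card X"
proof -
  have "real (card S) = (\<Sum>y\<in>X. \<Sum>s\<in>S. (cmod (e s y))\<^sup>2)"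
    using orthonormal_sum_squares[OF assms(3)] by simp
  also have "\<dots> \<le> (\<Sum>y\<in>X. 1)" using assms by (intro sum_mono bessel_at_point_le)
  finally show ?thesis by simp
qed

text \<open>If the family has as many members as there are points, then Bessel's inequality must be an
  equality at every point, so every point mass is its own projection.\<close>

lemma orthonormal_full_spans:
  assumes "finite X" "finite S" "orthonormal_on X S e" "card S = card X" "x \<in> X" "y \<in> X"
  shows "(\<Sum>s\<in>S. cnj (e s y) * e s x) = (if x = y then 1 else 0)"
proof -
  have le: "(\<Sum>s\<in>S. (cmod (e s z))\<^sup>2) \<le> 1" if "z \<in> X" for z
    using bessel_at_point_le[OF assms(1-3) that] .
  have "(\<Sum>z\<in>X. 1 - (\<Sum>s\<in>S. (cmod (e s z))\<^sup>2)) = 0"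
    using orthonormal_sum_squares[OF assms(3)] assms(4) by (simp add: sum_subtractf)
  then have "1 - (\<Sum>s\<in>S. (cmod (e s y))\<^sup>2) = 0"
    using sum_nonneg_eq_0_iff[of X "\<lambda>z. 1 - (\<Sum>s\<in>S. (cmod (e s z))\<^sup>2)"] le assms(1,6) by auto
  then have "(\<Sum>x\<in>X. (cmod ((if x = y then 1 else 0) - (\<Sum>s\<in>S. cnj (e s y) * e s x)))\<^sup>2) = 0"
    unfolding bessel_at_point[OF assms(1-3,6)] .
  from sum_norm_squares_eq_0D[OF assms(1) this assms(5)] show ?thesis by simp
qed

lemma linear_closedD:
  assumes "linear_closed V"
  shows "(\<lambda>x. 0) \<in> V"
    and "u \<in> V \<Longrightarrow> v \<in> V \<Longrightarrow> (\<lambda>x. u x + v x) \<in> V"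
    and "v \<in> V \<Longrightarrow> (\<lambda>x. c * v x) \<in> V"
  using assms by (auto simp: linear_closed_def)

lemma linear_closed_sum:
  assumes "linear_closed V" "finite S" "\<And>s. s \<in> S \<Longrightarrow> e s \<in> V"
  shows "(\<lambda>x. \<Sum>s\<in>S. c s * e s x) \<in> V"
  using assms(2,3)
proof (induction S rule: finite_induct)
  case (insert s S)
  then have "(\<lambda>x. c s * e s x) \<in> V" "(\<lambda>x. \<Sum>s\<in>S. c s * e s x) \<in> V"
    using assms(1) by (auto simp: linear_closed_def)
  then show ?case using insert(1,2) assms(1) by (auto simp: linear_closed_def)
qed (use assms(1) in \<open>simp add: linear_closed_def\<close>)

text \<open>A largest orthonormal family in \<open>V\<close> exists because of the bound on its size, and it spans \<open>V\<close>
  since the normalised residual of a vector outside its span would extend it.\<close>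

lemma orthonormal_basis_exists:
  assumes "finite X" "linear_closed V"
  obtains k :: nat and e where "orthonormal_on X {..<k} e" "\<And>j. j < k \<Longrightarrow> e j \<in> V"
    "\<And>v. v \<in> V \<Longrightarrow> \<exists>c. \<forall>x\<in>X. v x = (\<Sum>j<k. c j * e j x)"
proof -
  define P where "P k \<longleftrightarrow> (\<exists>e. orthonormal_on X {..<k} e \<and> (\<forall>j<k. e j \<in> V))" for k :: nat
  have "P 0" by (simp add: P_def orthonormal_on_def)
  moreover have "\<forall>k. P k \<longrightarrow> k \<le> card X"
    unfolding P_def using orthonormal_card_le[OF assms(1) finite_lessThan] by (metis card_lessThan)
  ultimately obtain k where k: "P k" and max: "\<And>m. P m \<Longrightarrow> m \<le> k"
    using Nat.ex_has_greatest_nat[of P 0 "card X"] by auto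
  from k obtain e where on: "orthonormal_on X {..<k} e" and eV: "\<And>j. j < k \<Longrightarrow> e j \<in> V"
    by (auto simp: P_def)
  have "\<exists>c. \<forall>x\<in>X. v x = (\<Sum>j<k. c j * e j x)" if v: "v \<in> V" for v
  proof (rule ccontr)
    assume no: "\<not> ?thesis"
    define r where "r = (\<lambda>x. v x - (\<Sum>j<k. inner_on X v (e j) * e j x))"
    have re: "inner_on X r (e j) = 0" if "j < k" for j
      using inner_on_residual[OF _ on, of j v] that by (simp add: r_def)
    have "(\<lambda>x. \<Sum>j<k. inner_on X v (e j) * e j x) \<in> V"
      by (rule linear_closed_sum) (use assms(2) eV in auto)
    from linear_closedD(2)[OF assms(2) v linear_closedD(3)[OF assms(2) this, of "- 1"]]
    have rV: "r \<in> V" by (simp add: r_def)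
    define q where "q = (\<Sum>x\<in>X. (cmod (r x))\<^sup>2)"
    have "q \<noteq> 0"
    proof
      assume q0: "q = 0"
      have "r x = 0" if "x \<in> X" for x
        by (rule sum_norm_squares_eq_0D[OF assms(1) q0[unfolded q_def] that])
      then have "\<forall>x\<in>X. v x = (\<Sum>j<k. inner_on X v (e j) * e j x)" by (simp add: r_def)
      then have "\<exists>c. \<forall>x\<in>X. v x = (\<Sum>j<k. c j * e j x)" by (rule exI[of _ "\<lambda>j. inner_on X v (e j)"])
      with no show False by (rule notE)
    qed
    moreover have "q \<ge> 0" unfolding q_def by (simp add: sum_nonneg)
    ultimately have q: "q > 0" by simp
    define c where "c = complex_of_real (1 / sqrt q)"
    have "(1 / sqrt q) * ((1 / sqrt q) * q) = 1" using q by (simp add: field_simps)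
    then have c: "c * (c * of_real q) = 1" "cnj c = c"
      unfolding c_def complex_cnj_complex_of_real of_real_mult[symmetric] by simp_all
    define w where "w = (\<lambda>x. c * r x)"
    have wV: "w \<in> V" unfolding w_def by (rule linear_closedD(3)[OF assms(2) rV])
    have we: "inner_on X w (e j) = 0" if "j < k" for j
      using re[OF that] by (simp add: w_def inner_on_scale_left)
    have "inner_on X r r = of_real q" by (simp only: inner_on_self q_def)
    then have "inner_on X w r = c * of_real q" by (simp add: w_def inner_on_scale_left)
    then have "inner_on X r w = c * of_real q"
      using c(2) inner_on_commute[of X r w] by simp
    then have ww: "inner_on X w w = 1"
      using inner_on_scale_left[of X c r w, folded w_def] c(1) by simp
    have ew: "inner_on X (e j) w = 0" if "j < k" for j
      using we[OF that] inner_on_commute[of X "e j" w] by simp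
    have "orthonormal_on X {..<Suc k} (e(k := w))"
      unfolding orthonormal_on_def
    proof (intro ballI)
      fix s t assume "s \<in> {..<Suc k}" "t \<in> {..<Suc k}"
      then consider "s < k" "t < k" | "s = k" "t < k" | "s < k" "t = k" | "s = k" "t = k"
        by (auto simp: less_Suc_eq)
      then show "inner_on X ((e(k := w)) s) ((e(k := w)) t) = (if s = t then 1 else 0)"
        using on we[of t] ew[of s] ww by cases (simp_all add: orthonormal_on_def)
    qed
    moreover have "(e(k := w)) j \<in> V" if "j < Suc k" for j
      using eV[of j] wV that by (cases "j = k") simp_all
    ultimately have "P (Suc k)" unfolding P_def by (intro exI[of _ "e(k := w)"]) simp
    from max[OF this] show False by simp
  qed
  from that[OF on eV this] show ?thesis .
qed

section \<open>Complex matrices\<close>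

lemma index_mult_mat_lessThan:
  assumes "A \<in> carrier_mat n m" "B \<in> carrier_mat m p" "i < n" "j < p"
  shows "(A * B) $$ (i, j) = (\<Sum>k<m. A $$ (i, k) * B $$ (k, j))"
  using assms by (auto simp: scalar_prod_def atLeast0LessThan)

lemma index_mult_mat_vec_lessThan:
  assumes "A \<in> carrier_mat n m" "v \<in> carrier_vec m" "i < n"
  shows "(A *\<^sub>v v) $ i = (\<Sum>k<m. A $$ (i, k) * v $ k)"
  using assms by (auto simp: scalar_prod_def atLeast0LessThan)

lemma mat_adjoint_carrier [simp]: "A \<in> carrier_mat n m \<Longrightarrow> mat_adjoint A \<in> carrier_mat m n"
  by (auto simp: mat_adjoint_def)

lemma index_mat_adjoint:
  fixes A :: "complex mat"
  assumes "A \<in> carrier_mat n m" "i < m" "j < n"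
  shows "mat_adjoint A $$ (i, j) = cnj (A $$ (j, i))"
  using assms by (auto simp: mat_adjoint_def mat_of_rows_def)

lemma mat_adjoint_mult:
  fixes A B :: "complex mat"
  assumes "A \<in> carrier_mat n m" "B \<in> carrier_mat m p"
  shows "mat_adjoint (A * B) = mat_adjoint B * mat_adjoint A"
proof (rule eq_matI)
  fix i j assume "i < dim_row (mat_adjoint B * mat_adjoint A)" "j < dim_col (mat_adjoint B * mat_adjoint A)"
  then have ij: "i < p" "j < n"
    using assms mat_adjoint_carrier[OF assms(1)] mat_adjoint_carrier[OF assms(2)] by auto
  have "mat_adjoint (A * B) $$ (i, j) = cnj (\<Sum>k<m. A $$ (j, k) * B $$ (k, i))"
    using ij index_mat_adjoint[OF mult_carrier_mat[OF assms] ij] index_mult_mat_lessThan[OF assms ij(2,1)]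
    by simp
  also have "\<dots> = (\<Sum>k<m. mat_adjoint B $$ (i, k) * mat_adjoint A $$ (k, j))"
    using assms ij by (auto simp: index_mat_adjoint mult.commute intro!: sum.cong)
  also have "\<dots> = (mat_adjoint B * mat_adjoint A) $$ (i, j)"
    using assms ij by (subst index_mult_mat_lessThan[of _ p m _ n]) auto
  finally show "mat_adjoint (A * B) $$ (i, j) = (mat_adjoint B * mat_adjoint A) $$ (i, j)" .
qed (use mat_adjoint_carrier[OF assms(1)] mat_adjoint_carrier[OF assms(2)]
      mat_adjoint_carrier[OF mult_carrier_mat[OF assms]] in \<open>auto simp del: mat_adjoint_carrier\<close>)

lemma invertible_matE:
  assumes "invertible_mat A" "A \<in> carrier_mat n n"
  obtains B where "B \<in> carrier_mat n n" "A * B = 1\<^sub>m n" "B * A = 1\<^sub>m n"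
proof -
  from assms obtain B where AB: "A * B = 1\<^sub>m n" and BA: "B * A = 1\<^sub>m (dim_row B)"
    unfolding invertible_mat_def inverts_mat_def by auto
  have "dim_col B = n" using arg_cong[OF AB, of dim_col] by simp
  moreover have "dim_row B = n" using arg_cong[OF BA, of dim_col] assms(2) by simp
  ultimately show ?thesis using that[of B] AB BA by auto
qed

lemma invertible_matI:
  assumes "A \<in> carrier_mat n n" "B \<in> carrier_mat n n" "A * B = 1\<^sub>m n" "B * A = 1\<^sub>m n"
  shows "invertible_mat A"
  using assms unfolding invertible_mat_def inverts_mat_def by auto

lemma invertible_mat_mult:
  assumes "invertible_mat A" "A \<in> carrier_mat n n" "invertible_mat B" "B \<in> carrier_mat n n"
  shows "invertible_mat (A * B)"
proof -
  obtain C where C: "C \<in> carrier_mat n n" "A * C = 1\<^sub>m n" "C * A = 1\<^sub>m n"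
    by (rule invertible_matE[OF assms(1,2)])
  obtain D where D: "D \<in> carrier_mat n n" "B * D = 1\<^sub>m n" "D * B = 1\<^sub>m n"
    by (rule invertible_matE[OF assms(3,4)])
  have "(A * B) * (D * C) = A * ((B * D) * C)"
    using assms(2,4) C(1) D(1) by (simp add: assoc_mult_mat[of _ n n _ n _ n])
  then have 1: "(A * B) * (D * C) = 1\<^sub>m n" using C D by simp
  have "(D * C) * (A * B) = D * ((C * A) * B)"
    using assms(2,4) C(1) D(1) by (simp add: assoc_mult_mat[of _ n n _ n _ n])
  then have 2: "(D * C) * (A * B) = 1\<^sub>m n" using C D assms(4) by simp
  show ?thesis
    by (rule invertible_matI[OF mult_carrier_mat[OF assms(2,4)] mult_carrier_mat[OF D(1) C(1)] 1 2])
qed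

text \<open>Translates subspaces of coordinate vectors into spaces of functions on \<open>{..<k}\<close>, to which the
  orthonormal bases above apply.\<close>

lemma mem_vec_subspace_closed:
  assumes "VectorSpace.subspace class_ring W (module_vec TYPE(complex) k)"
  shows "linear_closed {u. \<exists>w\<in>W. \<forall>i<k. u i = w $ i}"
proof -
  have W: "submodule class_ring W (module_vec TYPE(complex) k)"
    using assms by (simp add: VectorSpace.subspace_def)
  have sub: "W \<subseteq> carrier_vec k" and zero: "0\<^sub>v k \<in> W"
    and add: "\<And>v w. v \<in> W \<Longrightarrow> w \<in> W \<Longrightarrow> v + w \<in> W"
    and smult: "\<And>c v. v \<in> W \<Longrightarrow> c \<cdot>\<^sub>v v \<in> W"
    using W unfolding submodule_def by (auto simp: module_vec_simps)
  show ?thesis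
    unfolding linear_closed_def mem_Collect_eq
  proof (intro conjI ballI allI)
    show "\<exists>w\<in>W. \<forall>i<k. 0 = w $ i" using zero by (intro bexI[of _ "0\<^sub>v k"]) auto
  next
    fix u v :: "nat \<Rightarrow> complex" assume "u \<in> {u. \<exists>w\<in>W. \<forall>i<k. u i = w $ i}" "v \<in> {u. \<exists>w\<in>W. \<forall>i<k. u i
        = w $ i}"
    then obtain a b where ab: "a \<in> W" "b \<in> W" "\<forall>i<k. u i = a $ i" "\<forall>i<k. v i = b $ i" by auto
    then show "\<exists>w\<in>W. \<forall>i<k. u i + v i = w $ i"
      using add sub by (intro bexI[of _ "a + b"]) auto
  next
    fix c and v :: "nat \<Rightarrow> complex" assume "v \<in> {u. \<exists>w\<in>W. \<forall>i<k. u i = w $ i}"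
    then obtain a where "a \<in> W" "\<forall>i<k. v i = a $ i" by auto
    then show "\<exists>w\<in>W. \<forall>i<k. c * v i = w $ i"
      using smult sub by (intro bexI[of _ "c \<cdot>\<^sub>v a"]) auto
  qed
qed

section \<open>Schur's lemma\<close>

locale finite_group = group G for G :: "('g, 'm) monoid_scheme" (structure) +
  assumes finite_carrier: "finite (carrier G)"
begin

lemma unitary_rep_carrier:
  assumes "unitary_rep G \<rho>" "g \<in> carrier G"
  shows "\<rho> g \<in> carrier_mat (rep_degree G \<rho>) (rep_degree G \<rho>)"
  using assms by (simp add: unitary_rep_def)

lemma unitary_rep_one:
  "unitary_rep G \<rho> \<Longrightarrow> \<rho> \<one> = 1\<^sub>m (rep_degree G \<rho>)"
  by (simp add: unitary_rep_def)

lemma unitary_rep_mult: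
  "unitary_rep G \<rho> \<Longrightarrow> g \<in> carrier G \<Longrightarrow> h \<in> carrier G \<Longrightarrow> \<rho> (g \<otimes> h) = \<rho> g * \<rho> h"
  by (simp add: unitary_rep_def)

lemma unitary_rep_inv:
  assumes "unitary_rep G \<rho>" "g \<in> carrier G"
  shows "\<rho> (inv g) = mat_adjoint (\<rho> g)"
proof -
  let ?d = "rep_degree G \<rho>"
  note c = unitary_rep_carrier[OF assms(1)]
  have "\<rho> (inv g) = \<rho> (inv g) * (\<rho> g * mat_adjoint (\<rho> g))"
    using assms right_mult_one_mat[OF c[of "inv g"]] by (simp add: unitary_rep_def)
  also have "\<dots> = (\<rho> (inv g) * \<rho> g) * mat_adjoint (\<rho> g)"
    by (rule assoc_mult_mat[symmetric, OF c c mat_adjoint_carrier[OF c]]) (use assms(2) in simp_all)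
  also have "\<rho> (inv g) * \<rho> g = 1\<^sub>m ?d"
    using assms by (simp flip: unitary_rep_mult add: unitary_rep_one)
  also have "1\<^sub>m ?d * mat_adjoint (\<rho> g) = mat_adjoint (\<rho> g)"
    by (rule left_mult_one_mat[OF mat_adjoint_carrier[OF c[OF assms(2)]]])
  finally show ?thesis .
qed

lemma rep_entry_mult:
  assumes "unitary_rep G \<rho>" "g \<in> carrier G" "h \<in> carrier G" "i < rep_degree G \<rho>" "j < rep_degree G \<rho>"
  shows "\<rho> (g \<otimes> h) $$ (i, j) = (\<Sum>k<rep_degree G \<rho>. \<rho> g $$ (i, k) * \<rho> h $$ (k, j))"
  unfolding unitary_rep_mult[OF assms(1-3)]
  by (rule index_mult_mat_lessThan[OF unitary_rep_carrier[OF assms(1,2)] unitary_rep_carrier[OF assms(1,3)] assms(4,5)])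

lemma rep_entry_inv:
  assumes "unitary_rep G \<rho>" "g \<in> carrier G" "i < rep_degree G \<rho>" "j < rep_degree G \<rho>"
  shows "\<rho> (inv g) $$ (i, j) = cnj (\<rho> g $$ (j, i))"
  using assms unitary_rep_carrier[OF assms(1,2)]
  by (simp add: unitary_rep_inv index_mat_adjoint)

lemma rep_entry_one:
  assumes "unitary_rep G \<rho>" "i < rep_degree G \<rho>" "j < rep_degree G \<rho>"
  shows "\<rho> \<one> $$ (i, j) = (if i = j then 1 else 0)"
  using assms by (simp add: unitary_rep_one)

lemma rep_entry_inv_mult:
  assumes "unitary_rep G \<rho>" "g \<in> carrier G" "h \<in> carrier G" "i < rep_degree G \<rho>" "j < rep_degree G \<rho>"
  shows "\<rho> (inv g \<otimes> h) $$ (i, j) = (\<Sum>k<rep_degree G \<rho>. cnj (\<rho> g $$ (k, i)) * \<rho> h $$ (k, j))"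
  using assms by (simp add: rep_entry_mult rep_entry_inv)

lemma rep_column_orthonormal:
  assumes "unitary_rep G \<rho>" "g \<in> carrier G" "i < rep_degree G \<rho>" "j < rep_degree G \<rho>"
  shows "(\<Sum>k<rep_degree G \<rho>. cnj (\<rho> g $$ (k, i)) * \<rho> g $$ (k, j)) = (if i = j then 1 else 0)"
  using rep_entry_inv_mult[OF assms(1,2,2,3,4)] rep_entry_one[OF assms(1,3,4)] assms(2) by simp

lemma irreducible_rep_unitary: "irreducible_rep G \<rho> \<Longrightarrow> unitary_rep G \<rho>"
  by (simp add: irreducible_rep_def)

lemma irreducible_rep_degree_pos: "irreducible_rep G \<rho> \<Longrightarrow> rep_degree G \<rho> > 0"
  by (simp add: irreducible_rep_def)

text \<open>An eigenspace of \<open>T\<close> is invariant and nonzero, hence everything.\<close>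

lemma schur_commutant:
  assumes irr: "irreducible_rep G \<rho>"
    and T: "T \<in> carrier_mat (rep_degree G \<rho>) (rep_degree G \<rho>)"
    and comm: "\<And>g. g \<in> carrier G \<Longrightarrow> T * \<rho> g = \<rho> g * T"
  obtains c where "T = c \<cdot>\<^sub>m 1\<^sub>m (rep_degree G \<rho>)"
proof -
  define d where "d = rep_degree G \<rho>"
  note un = irreducible_rep_unitary[OF irr]
  have d: "d > 0" using irreducible_rep_degree_pos[OF irr] by (simp add: d_def)
  have Td: "T \<in> carrier_mat d d" using T by (simp add: d_def)
  have rc: "\<rho> g \<in> carrier_mat d d" if "g \<in> carrier G" for g
    using unitary_rep_carrier[OF un that] by (simp add: d_def)
  from spectrum_non_empty[OF Td d] obtain c v where v: "eigenvector T v c"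
    by (auto simp: spectrum_def eigenvalue_def)
  define W where "W = {w \<in> carrier_vec d. T *\<^sub>v w = c \<cdot>\<^sub>v w}"
  have "VectorSpace.subspace class_ring W (module_vec TYPE(complex) d)"
    unfolding VectorSpace.subspace_def submodule_def
  proof (intro conjI allI impI)
    show "vectorspace class_ring (module_vec TYPE(complex) d)"
      by (rule vec_vs)
    show "Module.module class_ring (module_vec TYPE(complex) d)"
      by (rule vec_module)
    show "v \<in> W \<Longrightarrow> w \<in> W \<Longrightarrow> v \<oplus>\<^bsub>module_vec TYPE(complex) d\<^esub> w \<in> W" for v w
      using Td by (auto simp: W_def module_vec_simps mult_add_distrib_mat_vec[of T d d] smult_add_distrib_vec[of _ d])
    show "v \<in> W \<Longrightarrow> k \<odot>\<^bsub>module_vec TYPE(complex) d\<^esub> v \<in> W" for k v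
      using Td by (auto simp: W_def module_vec_simps mult_mat_vec[of T d d] smult_smult_assoc mult.commute)
    show "W \<subseteq> carrier (module_vec TYPE(complex) d)" by (auto simp: W_def module_vec_simps)
    show "\<zero>\<^bsub>module_vec TYPE(complex) d\<^esub> \<in> W"
      using Td by (auto simp: W_def module_vec_simps)
  qed
  moreover have "\<rho> g *\<^sub>v w \<in> W" if "g \<in> carrier G" "w \<in> W" for g w
  proof -
    have w: "w \<in> carrier_vec d" "T *\<^sub>v w = c \<cdot>\<^sub>v w" using that(2) by (auto simp: W_def)
    have "T *\<^sub>v (\<rho> g *\<^sub>v w) = (T * \<rho> g) *\<^sub>v w"
      using Td rc[OF that(1)] w(1) by (simp add: assoc_mult_mat_vec[of _ d d _ d])
    also have "\<dots> = \<rho> g *\<^sub>v (T *\<^sub>v w)"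
      unfolding comm[OF that(1)] using Td rc[OF that(1)] w(1) by
          (simp add: assoc_mult_mat_vec[of _ d d _ d])
    also have "\<dots> = c \<cdot>\<^sub>v (\<rho> g *\<^sub>v w)"
      unfolding w(2) using rc[OF that(1)] w(1) by (simp add: mult_mat_vec[of _ d d])
    finally show ?thesis using rc[OF that(1)] w(1) by (simp add: W_def)
  qed
  ultimately have "W = {0\<^sub>v d} \<or> W = carrier_vec d"
    using irr unfolding irreducible_rep_def d_def by blast
  moreover have "v \<in> W" "v \<noteq> 0\<^sub>v d"
    using v Td by (auto simp: eigenvector_def W_def)
  ultimately have W: "W = carrier_vec d" by auto
  have "T = c \<cdot>\<^sub>m 1\<^sub>m d"
  proof (rule eq_matI)
    fix i j assume "i < dim_row (c \<cdot>\<^sub>m 1\<^sub>m d)" "j < dim_col (c \<cdot>\<^sub>m 1\<^sub>m d)"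
    then have ij: "i < d" "j < d" by auto
    have "unit_vec d j \<in> W" using W by simp
    then have "(T *\<^sub>v unit_vec d j) $ i = (c \<cdot>\<^sub>v unit_vec d j) $ i" by (simp add: W_def)
    moreover have "(T *\<^sub>v unit_vec d j) $ i = T $$ (i, j)"
      using Td ij by (simp add: scalar_prod_right_unit)
    ultimately show "T $$ (i, j) = (c \<cdot>\<^sub>m 1\<^sub>m d) $$ (i, j)" using ij by simp
  qed (use Td in auto)
  then show ?thesis using that by (simp add: d_def)
qed

text \<open>For a nonzero intertwiner \<open>T\<close> the products \<open>T\<^sup>* T\<close> and \<open>T T\<^sup>*\<close> commute with \<open>\<rho>\<close> and \<open>\<sigma>\<close> and are
  therefore scalars \<open>a\<close> and \<open>b\<close>. These agree because \<open>T (T\<^sup>* T) = (T T\<^sup>*) T\<close>, and comparing traces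
  then gives equal degrees. So \<open>T\<^sup>* / a\<close> is an inverse of \<open>T\<close>.\<close>

lemma schur_inequivalent:
  assumes irr: "irreducible_rep G \<rho>" "irreducible_rep G \<sigma>"
    and neq: "(\<rho>, \<sigma>) \<notin> rep_equivalence G"
    and T: "T \<in> carrier_mat (rep_degree G \<sigma>) (rep_degree G \<rho>)"
    and comm: "\<And>g. g \<in> carrier G \<Longrightarrow> T * \<rho> g = \<sigma> g * T"
  shows "T = 0\<^sub>m (rep_degree G \<sigma>) (rep_degree G \<rho>)"
proof (rule ccontr)
  define d e S where "d = rep_degree G \<rho>" and "e = rep_degree G \<sigma>" and "S = mat_adjoint T"
  assume "T \<noteq> 0\<^sub>m (rep_degree G \<sigma>) (rep_degree G \<rho>)"
  then have T0: "T \<noteq> 0\<^sub>m e d" by (simp add: d_def e_def)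
  have Tc: "T \<in> carrier_mat e d" using T by (simp add: d_def e_def)
  have Sc: "S \<in> carrier_mat d e" using Tc by (simp add: S_def)
  note un = irr[THEN irreducible_rep_unitary]
  have rc: "\<rho> g \<in> carrier_mat d d" "\<sigma> g \<in> carrier_mat e e" if "g \<in> carrier G" for g
    using unitary_rep_carrier[OF un(1) that] unitary_rep_carrier[OF un(2) that]
    by (simp_all add: d_def e_def)
  \<comment> \<open>Unitarity turns the adjoint of the intertwining relation at \<open>inv g\<close> into one at \<open>g\<close>.\<close>
  have comm': "S * \<sigma> g = \<rho> g * S" if g: "g \<in> carrier G" for g
  proof -
    have g': "inv g \<in> carrier G" using g by simp
    have "mat_adjoint (T * \<rho> (inv g)) = mat_adjoint (\<rho> (inv g)) * S"
      unfolding S_def by (rule mat_adjoint_mult[OF Tc rc(1)[OF g']])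
    moreover have "mat_adjoint (\<sigma> (inv g) * T) = S * mat_adjoint (\<sigma> (inv g))"
      unfolding S_def by (rule mat_adjoint_mult[OF rc(2)[OF g'] Tc])
    ultimately show ?thesis
      using comm[OF g'] unitary_rep_inv[OF un(1) g'] unitary_rep_inv[OF un(2) g'] g by simp
  qed
  have ST: "(S * T) * \<rho> g = \<rho> g * (S * T)" and TS: "(T * S) * \<sigma> g = \<sigma> g * (T * S)"
    if g: "g \<in> carrier G" for g
  proof -
    have "(S * T) * \<rho> g = S * (T * \<rho> g)" using Sc Tc rc(1)[OF g] by (rule assoc_mult_mat)
    also have "\<dots> = (S * \<sigma> g) * T" unfolding comm[OF g]
      using Sc Tc rc(2)[OF g] by (intro assoc_mult_mat[symmetric])
    also have "\<dots> = \<rho> g * (S * T)" unfolding comm'[OF g]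
      using Sc Tc rc(1)[OF g] by (intro assoc_mult_mat)
    finally show "(S * T) * \<rho> g = \<rho> g * (S * T)" .
    have "(T * S) * \<sigma> g = T * (S * \<sigma> g)" using Tc Sc rc(2)[OF g] by (rule assoc_mult_mat)
    also have "\<dots> = (T * \<rho> g) * S" unfolding comm'[OF g]
      using Sc Tc rc(1)[OF g] by (intro assoc_mult_mat[symmetric])
    also have "\<dots> = \<sigma> g * (T * S)" unfolding comm[OF g]
      using Sc Tc rc(2)[OF g] by (intro assoc_mult_mat)
    finally show "(T * S) * \<sigma> g = \<sigma> g * (T * S)" .
  qed
  have "S * T \<in> carrier_mat d d" "T * S \<in> carrier_mat e e" using Sc Tc by auto
  then obtain a b where a: "S * T = a \<cdot>\<^sub>m 1\<^sub>m d" and b: "T * S = b \<cdot>\<^sub>m 1\<^sub>m e"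
    using schur_commutant[OF irr(1) _ ST] schur_commutant[OF irr(2) _ TS] unfolding d_def e_def by metis
  from T0 obtain i j where ij: "i < e" "j < d" "T $$ (i, j) \<noteq> 0"
    using Tc by (metis carrier_matD eq_matI index_zero_mat)
  have frob: "(S * T) $$ (k, k) = of_real (\<Sum>l<e. (cmod (T $$ (l, k)))\<^sup>2)" if "k < d" for k
    using that unfolding index_mult_mat_lessThan[OF Sc Tc that that] of_real_sum complex_norm_square
    by (intro sum.cong) (simp_all add: S_def index_mat_adjoint[OF Tc])
  have frob': "(T * S) $$ (l, l) = of_real (\<Sum>k<d. (cmod (T $$ (l, k)))\<^sup>2)" if "l < e" for l
    using that unfolding index_mult_mat_lessThan[OF Tc Sc that that] of_real_sum complex_norm_square
    by (intro sum.cong) (simp_all add: S_def index_mat_adjoint[OF Tc])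
  have a0: "a \<noteq> 0"
  proof
    assume "a = 0"
    then have "(S * T) $$ (j, j) = 0" using a ij(2) by simp
    then have "(\<Sum>l<e. (cmod (T $$ (l, j)))\<^sup>2) = 0"
      unfolding frob[OF ij(2)] of_real_eq_0_iff .
    moreover have "(cmod (T $$ (i, j)))\<^sup>2 \<le> (\<Sum>l<e. (cmod (T $$ (l, j)))\<^sup>2)"
      using ij by (intro member_le_sum) auto
    ultimately show False using ij(3) by simp
  qed
  have "T * (S * T) = (T * S) * T" using Tc Sc by (intro assoc_mult_mat[symmetric])
  then have "a \<cdot>\<^sub>m T = b \<cdot>\<^sub>m T" unfolding a b
    using Tc by (simp add: mult_smult_distrib[OF Tc one_carrier_mat] mult_smult_assoc_mat[OF one_carrier_mat Tc])
  then have "(a \<cdot>\<^sub>m T) $$ (i, j) = (b \<cdot>\<^sub>m T) $$ (i, j)" by simp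
  then have ab: "a = b" using ij Tc by simp
  have "a * of_nat d = (\<Sum>k<d. (S * T) $$ (k, k))" unfolding a by simp
  also have "\<dots> = of_real (\<Sum>k<d. \<Sum>l<e. (cmod (T $$ (l, k)))\<^sup>2)"
    using frob by simp
  also have "\<dots> = (\<Sum>l<e. (T * S) $$ (l, l))"
    using frob' by (subst sum.swap) simp
  also have "\<dots> = a * of_nat e" unfolding b ab by simp
  finally have de: "d = e" using a0 by simp
  define Q where "Q = inverse a \<cdot>\<^sub>m S"
  have "Q * T = 1\<^sub>m d"
    using mult_smult_assoc_mat[OF Sc Tc, of "inverse a"] a a0 unfolding Q_def by (intro eq_matI) auto
  moreover have "T * Q = 1\<^sub>m d"
    using mult_smult_distrib[OF Tc Sc, of "inverse a"] b ab a0 de unfolding Q_def by (intro eq_matI) auto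
  moreover have "Q \<in> carrier_mat d d" using Sc de by (simp add: Q_def)
  ultimately have "invertible_mat T"
    using Tc de unfolding invertible_mat_def inverts_mat_def square_mat.simps by auto
  then have "(\<rho>, \<sigma>) \<in> rep_equivalence G"
    using irr comm Tc de unfolding rep_equivalence_def d_def e_def by auto
  with neq show False by (rule notE)
qed

section \<open>Schur orthogonality\<close>

lemma sum_left_translate:
  "h \<in> carrier G \<Longrightarrow> (\<Sum>g\<in>carrier G. f (h \<otimes> g)) = (\<Sum>g\<in>carrier G. f g)"
  by (rule sum.reindex_bij_witness[of _ "\<lambda>g. inv h \<otimes> g" "\<lambda>g. h \<otimes> g"])
     (auto simp: m_assoc[symmetric])

lemma sum_right_translate:
  "h \<in> carrier G \<Longrightarrow> (\<Sum>g\<in>carrier G. f (g \<otimes> h)) = (\<Sum>g\<in>carrier G. f g)"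
  by (rule sum.reindex_bij_witness[of _ "\<lambda>g. g \<otimes> inv h" "\<lambda>g. g \<otimes> h"])
     (auto simp: m_assoc)

text \<open>The matrix is \<open>\<Sum>g. \<sigma> g E \<rho> (inv g)\<close> for the matrix unit \<open>E\<close> at \<open>(k, l)\<close>; averaging over the group
  makes it an intertwiner.\<close>

lemma averaged_intertwiner:
  assumes un: "unitary_rep G \<rho>" "unitary_rep G \<sigma>" and h: "h \<in> carrier G"
    and kl: "k < rep_degree G \<sigma>" "l < rep_degree G \<rho>"
  defines "T \<equiv> mat (rep_degree G \<sigma>) (rep_degree G \<rho>)
                 (\<lambda>(i, j). inner_on (carrier G) (\<lambda>g. \<sigma> g $$ (i, k)) (\<lambda>g. \<rho> g $$ (j, l)))"
  shows "T * \<rho> h = \<sigma> h * T"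
proof (rule eq_matI)
  define d e where "d = rep_degree G \<rho>" and "e = rep_degree G \<sigma>"
  have Tc: "T \<in> carrier_mat e d" by (simp add: T_def d_def e_def)
  have rc: "\<rho> h \<in> carrier_mat d d" "\<sigma> h \<in> carrier_mat e e"
    using unitary_rep_carrier[OF un(1) h] unitary_rep_carrier[OF un(2) h] by (simp_all add: d_def e_def)
  fix i j assume "i < dim_row (\<sigma> h * T)" "j < dim_col (\<sigma> h * T)"
  then have ij: "i < e" "j < d" using Tc rc by auto
  have hi: "inv h \<in> carrier G" using h by simp
  have "(T * \<rho> h) $$ (i, j) = (\<Sum>m<d. \<Sum>g\<in>carrier G. \<sigma> g $$ (i, k) * cnj (\<rho> g $$ (m, l)) * \<rho> h $$ (m, j))"
    unfolding index_mult_mat_lessThan[OF Tc rc(1) ij]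
    using ij by (intro sum.cong) (simp_all add: T_def d_def e_def inner_on_def sum_distrib_right)
  also have "\<dots> = (\<Sum>g\<in>carrier G. \<sigma> g $$ (i, k) * cnj (\<Sum>m<d. cnj (\<rho> h $$ (m, j)) * \<rho> g $$ (m, l)))"
    by (subst sum.swap) (simp add: sum_distrib_left mult_ac)
  also have "\<dots> = (\<Sum>g\<in>carrier G. \<sigma> g $$ (i, k) * cnj (\<rho> (inv h \<otimes> g) $$ (j, l)))"
    using rep_entry_inv_mult[OF un(1) h _ ij(2)[unfolded d_def] kl(2)]
    by (intro sum.cong) (simp_all add: d_def)
  also have "\<dots> = (\<Sum>g\<in>carrier G. \<sigma> (h \<otimes> g) $$ (i, k) * cnj (\<rho> (inv h \<otimes> (h \<otimes> g)) $$ (j, l)))"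
    by (rule sum_left_translate[OF h, symmetric])
  also have "\<dots> = (\<Sum>g\<in>carrier G. \<Sum>m<e. \<sigma> h $$ (i, m) * (\<sigma> g $$ (m, k) * cnj (\<rho> g $$ (j, l))))"
    using h ij kl rep_entry_mult[OF un(2) h _ _ kl(1)]
    by (intro sum.cong) (simp_all add: e_def m_assoc[symmetric] sum_distrib_right mult.assoc)
  also have "\<dots> = (\<Sum>m<e. \<sigma> h $$ (i, m) * T $$ (m, j))"
    using ij by (subst sum.swap) (simp add: T_def d_def e_def inner_on_def sum_distrib_left)
  also have "\<dots> = (\<sigma> h * T) $$ (i, j)"
    by (rule index_mult_mat_lessThan[OF rc(2) Tc ij, symmetric])
  finally show "(T * \<rho> h) $$ (i, j) = (\<sigma> h * T) $$ (i, j)" .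
qed (use unitary_rep_carrier[OF un(1) h] unitary_rep_carrier[OF un(2) h] in \<open>auto simp: T_def\<close>)

lemma schur_orthogonality_inequivalent:
  assumes "irreducible_rep G \<rho>" "irreducible_rep G \<sigma>" "(\<rho>, \<sigma>) \<notin> rep_equivalence G"
    "i < rep_degree G \<sigma>" "k < rep_degree G \<sigma>" "j < rep_degree G \<rho>" "l < rep_degree G \<rho>"
  shows "inner_on (carrier G) (\<lambda>g. \<sigma> g $$ (i, k)) (\<lambda>g. \<rho> g $$ (j, l)) = 0"
proof -
  let ?T = "mat (rep_degree G \<sigma>) (rep_degree G \<rho>)
              (\<lambda>(i, j). inner_on (carrier G) (\<lambda>g. \<sigma> g $$ (i, k)) (\<lambda>g. \<rho> g $$ (j, l)))"
  have "?T = 0\<^sub>m (rep_degree G \<sigma>) (rep_degree G \<rho>)"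
    by (rule schur_inequivalent[OF assms(1-3)])
       (use assms averaged_intertwiner irreducible_rep_unitary in auto)
  then have "?T $$ (i, j) = 0" using assms by simp
  then show ?thesis using assms by simp
qed

text \<open>The averaged matrix unit is a scalar, and its trace determines the scalar.\<close>

lemma schur_orthogonality_same:
  assumes irr: "irreducible_rep G \<rho>"
    and "i < rep_degree G \<rho>" "k < rep_degree G \<rho>" "j < rep_degree G \<rho>" "l < rep_degree G \<rho>"
  shows "of_nat (rep_degree G \<rho>) * inner_on (carrier G) (\<lambda>g. \<rho> g $$ (i, k)) (\<lambda>g. \<rho> g $$ (j, l))
       = (if i = j \<and> k = l then of_nat (card (carrier G)) else 0)"
proof -
  define d where "d = rep_degree G \<rho>"
  note un = irreducible_rep_unitary[OF irr]
  note ijkl = assms(2-5)[folded d_def]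
  let ?T = "mat d d (\<lambda>(i, j). inner_on (carrier G) (\<lambda>g. \<rho> g $$ (i, k)) (\<lambda>g. \<rho> g $$ (j, l)))"
  obtain c where c: "?T = c \<cdot>\<^sub>m 1\<^sub>m d"
    using schur_commutant[OF irr, of ?T] averaged_intertwiner[OF un un] ijkl by (auto simp: d_def)
  have T: "inner_on (carrier G) (\<lambda>g. \<rho> g $$ (i, k)) (\<lambda>g. \<rho> g $$ (j, l)) = (if i = j then c else 0)"
    if "i < d" "j < d" for i j
    using arg_cong[OF c, of "\<lambda>M. M $$ (i, j)"] that by simp
  have "of_nat d * c = (\<Sum>m<d. inner_on (carrier G) (\<lambda>g. \<rho> g $$ (m, k)) (\<lambda>g. \<rho> g $$ (m, l)))"
    using T by simp
  also have "\<dots> = (\<Sum>g\<in>carrier G. \<Sum>m<d. cnj (\<rho> g $$ (m, l)) * \<rho> g $$ (m, k))"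
    unfolding inner_on_def by (subst sum.swap) (simp add: mult.commute)
  also have "\<dots> = (\<Sum>g\<in>carrier G. if l = k then 1 else 0)"
    using rep_column_orthonormal[OF un] ijkl by (intro sum.cong) (simp_all add: d_def)
  finally have "of_nat d * c = (if k = l then of_nat (card (carrier G)) else 0)" by auto
  then show ?thesis using T[OF ijkl(1,3)] by (auto simp: d_def)
qed

section \<open>Irreducible characters\<close>

definition rep_character :: "('g \<Rightarrow> complex mat) \<Rightarrow> 'g \<Rightarrow> complex" where
  "rep_character \<rho> g = (\<Sum>i<rep_degree G \<rho>. \<rho> g $$ (i, i))"

lemma inner_rep_character:
  "inner_on (carrier G) (rep_character \<sigma>) (rep_character \<rho>)
   = (\<Sum>i<rep_degree G \<sigma>. \<Sum>j<rep_degree G \<rho>.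
        inner_on (carrier G) (\<lambda>g. \<sigma> g $$ (i, i)) (\<lambda>g. \<rho> g $$ (j, j)))"
proof -
  have "inner_on (carrier G) (rep_character \<sigma>) (rep_character \<rho>)
     = (\<Sum>g\<in>carrier G. \<Sum>i<rep_degree G \<sigma>. \<Sum>j<rep_degree G \<rho>. \<sigma> g $$ (i, i) * cnj (\<rho> g $$ (j, j)))"
    by (simp add: inner_on_def rep_character_def sum_product)
  also have "\<dots> = (\<Sum>i<rep_degree G \<sigma>. \<Sum>g\<in>carrier G. \<Sum>j<rep_degree G \<rho>. \<sigma> g $$ (i, i) * cnj (\<rho> g $$ (j, j)))"
    by (rule sum.swap)
  also have "\<dots> = (\<Sum>i<rep_degree G \<sigma>. \<Sum>j<rep_degree G \<rho>. \<Sum>g\<in>carrier G. \<sigma> g $$ (i, i) * cnj (\<rho> g $$ (j, j)))"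
    by (intro sum.cong sum.swap refl)
  finally show ?thesis by (simp add: inner_on_def)
qed

lemma rep_character_orthogonal:
  assumes "irreducible_rep G \<rho>" "irreducible_rep G \<sigma>" "(\<rho>, \<sigma>) \<notin> rep_equivalence G"
  shows "inner_on (carrier G) (rep_character \<sigma>) (rep_character \<rho>) = 0"
  unfolding inner_rep_character using schur_orthogonality_inequivalent[OF assms] by simp

lemma rep_character_norm:
  assumes "irreducible_rep G \<rho>"
  shows "inner_on (carrier G) (rep_character \<rho>) (rep_character \<rho>) = of_nat (card (carrier G))"
proof -
  let ?d = "rep_degree G \<rho>"
  have "of_nat ?d * inner_on (carrier G) (rep_character \<rho>) (rep_character \<rho>)
      = (\<Sum>i<?d. \<Sum>j<?d. if i = j \<and> i = j then of_nat (card (carrier G)) else 0)"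
    unfolding inner_rep_character sum_distrib_left
    using schur_orthogonality_same[OF assms] by (intro sum.cong refl) simp
  also have "\<dots> = of_nat ?d * of_nat (card (carrier G))" by simp
  finally show ?thesis using irreducible_rep_degree_pos[OF assms] by simp
qed

lemma rep_character_commute:
  assumes "unitary_rep G \<rho>" "g \<in> carrier G" "h \<in> carrier G"
  shows "rep_character \<rho> (g \<otimes> h) = rep_character \<rho> (h \<otimes> g)"
proof -
  have "rep_character \<rho> (g \<otimes> h)
     = (\<Sum>i<rep_degree G \<rho>. \<Sum>k<rep_degree G \<rho>. \<rho> h $$ (k, i) * \<rho> g $$ (i, k))"
    using assms by (simp add: rep_character_def rep_entry_mult mult.commute)
  also have "\<dots> = rep_character \<rho> (h \<otimes> g)"
    using assms by (subst sum.swap) (simp add: rep_character_def rep_entry_mult)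
  finally show ?thesis .
qed

lemma rep_character_conj:
  assumes "unitary_rep G \<rho>" "g \<in> carrier G" "h \<in> carrier G"
  shows "rep_character \<rho> (h \<otimes> g \<otimes> inv h) = rep_character \<rho> g"
  using rep_character_commute[OF assms(1), of "h \<otimes> g" "inv h"] assms by (simp add: m_assoc[symmetric])

lemma rep_equivalence_character:
  assumes "(\<rho>, \<sigma>) \<in> rep_equivalence G" "g \<in> carrier G"
  shows "rep_character \<rho> g = rep_character \<sigma> g"
proof -
  define d where "d = rep_degree G \<rho>"
  from assms obtain P where irr: "irreducible_rep G \<rho>" "irreducible_rep G \<sigma>"
    and deg: "rep_degree G \<sigma> = d" and P: "P \<in> carrier_mat d d" "invertible_mat P"
    and int: "P * \<rho> g = \<sigma> g * P"
    unfolding rep_equivalence_def d_def by auto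
  obtain Q where Q: "Q \<in> carrier_mat d d" and PQ: "P * Q = 1\<^sub>m d" and QP: "Q * P = 1\<^sub>m d"
    by (rule invertible_matE[OF P(2,1)])
  have rc: "\<rho> g \<in> carrier_mat d d" "\<sigma> g \<in> carrier_mat d d"
    using unitary_rep_carrier[OF irr(1)[THEN irreducible_rep_unitary] assms(2)]
      unitary_rep_carrier[OF irr(2)[THEN irreducible_rep_unitary] assms(2)] deg by (simp_all add: d_def)
  have "\<sigma> g = \<sigma> g * (P * Q)" unfolding PQ using rc by simp
  also have "\<dots> = (P * \<rho> g) * Q" unfolding int using rc P(1) Q by (intro assoc_mult_mat[symmetric])
  finally have sg: "\<sigma> g = (P * \<rho> g) * Q" .
  have "\<rho> g = (Q * P) * \<rho> g" unfolding QP using rc Q by simp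
  also have "\<dots> = Q * (P * \<rho> g)" using rc P(1) Q by (intro assoc_mult_mat)
  finally have rg: "\<rho> g = Q * (P * \<rho> g)" .
  have PR: "P * \<rho> g \<in> carrier_mat d d" using P(1) rc by simp
  have "rep_character \<sigma> g = (\<Sum>i<d. \<Sum>k<d. (P * \<rho> g) $$ (i, k) * Q $$ (k, i))"
    unfolding rep_character_def deg using sg index_mult_mat_lessThan[OF PR Q] by (intro sum.cong) auto
  also have "\<dots> = (\<Sum>k<d. \<Sum>i<d. Q $$ (k, i) * (P * \<rho> g) $$ (i, k))"
    by (subst sum.swap) (simp add: mult.commute)
  also have "\<dots> = rep_character \<rho> g"
    unfolding rep_character_def d_def[symmetric]
        using rg index_mult_mat_lessThan[OF Q PR] by (intro sum.cong) auto
  finally show ?thesis by simp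
qed

section \<open>Completeness of the irreducible characters\<close>

text \<open>An orthonormal basis, inside \<open>V\<close>, of a subrepresentation of the right regular representation.\<close>

definition translation_system :: "('g \<Rightarrow> complex) set \<Rightarrow> nat \<Rightarrow> (nat \<Rightarrow> 'g \<Rightarrow> complex) \<Rightarrow> bool" where
  "translation_system V k e \<longleftrightarrow> orthonormal_on (carrier G) {..<k} e \<and> (\<forall>j<k. e j \<in> V) \<and>
     (\<forall>h\<in>carrier G. \<forall>j<k. \<exists>c. \<forall>x\<in>carrier G. e j (x \<otimes> h) = (\<Sum>i<k. c i * e i x))"

text \<open>The subrepresentation spanned by \<open>e\<close>, written in the basis \<open>e\<close>.\<close>

definition translation_matrix :: "nat \<Rightarrow> (nat \<Rightarrow> 'g \<Rightarrow> complex) \<Rightarrow> 'g \<Rightarrow> complex mat" where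
  "translation_matrix k e h =
     mat k k (\<lambda>(i, j). inner_on (carrier G) (\<lambda>x. e j (x \<otimes> h)) (e i))"

lemma translation_matrix_expand:
  assumes "translation_system V k e" "h \<in> carrier G" "j < k" "x \<in> carrier G"
  shows "e j (x \<otimes> h) = (\<Sum>i<k. translation_matrix k e h $$ (i, j) * e i x)"
proof -
  from assms obtain c where c: "\<forall>x\<in>carrier G. e j (x \<otimes> h) = (\<Sum>i<k. c i * e i x)"
    unfolding translation_system_def by blast
  have "translation_matrix k e h $$ (i, j) = c i" if i: "i < k" for i
  proof -
    have "translation_matrix k e h $$ (i, j) = inner_on (carrier G) (\<lambda>x. \<Sum>l<k. c l * e l x) (e i)"
      using c i assms(3) by (simp add: translation_matrix_def inner_on_def)
    also have "\<dots> = (\<Sum>l<k. c l * inner_on (carrier G) (e l) (e i))" by (rule inner_on_sum_left)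
    also have "\<dots> = (\<Sum>l<k. if l = i then c l else 0)"
      using assms(1) i by (intro sum.cong) (auto simp: translation_system_def orthonormal_on_def)
    finally show ?thesis using i by simp
  qed
  then show ?thesis using c assms(4) by simp
qed

lemma translation_matrix_unitary_rep:
  assumes sys: "translation_system V k e"
  shows "unitary_rep G (translation_matrix k e)" "rep_degree G (translation_matrix k e) = k"
proof -
  define \<rho> where "\<rho> = translation_matrix k e"
  have on: "inner_on (carrier G) (e i) (e j) = (if i = j then 1 else 0)" if "i < k" "j < k" for i j
    using sys that by (auto simp: translation_system_def orthonormal_on_def)
  have rc: "\<rho> h \<in> carrier_mat k k" for h by (simp add: \<rho>_def translation_matrix_def)
  have entry: "\<rho> h $$ (i, j) = inner_on (carrier G) (\<lambda>x. e j (x \<otimes> h)) (e i)" if "i < k" "j < k" for h i j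
    using that by (simp add: \<rho>_def translation_matrix_def)
  have deg: "rep_degree G \<rho> = k" using carrier_matD(1)[OF rc] by (simp only: rep_degree_def)
  have one: "\<rho> \<one> = 1\<^sub>m k"
  proof (rule eq_matI)
    fix i j assume "i < dim_row (1\<^sub>m k :: complex mat)" "j < dim_col (1\<^sub>m k :: complex mat)"
    then have ij: "i < k" "j < k" by auto
    have "\<rho> \<one> $$ (i, j) = inner_on (carrier G) (e j) (e i)"
      unfolding entry[OF ij] by (simp add: inner_on_def)
    then show "\<rho> \<one> $$ (i, j) = 1\<^sub>m k $$ (i, j)" using on ij by simp
  qed (use rc[of "\<one>"] in auto)
  have mult: "\<rho> (g \<otimes> h) = \<rho> g * \<rho> h" if gh: "g \<in> carrier G" "h \<in> carrier G" for g h
  proof (rule eq_matI)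
    fix l j assume "l < dim_row (\<rho> g * \<rho> h)" "j < dim_col (\<rho> g * \<rho> h)"
    then have lj: "l < k" "j < k" using rc[of g] rc[of h] by auto
    have "e j (x \<otimes> (g \<otimes> h)) = (\<Sum>i<k. \<rho> h $$ (i, j) * e i (x \<otimes> g))" if "x \<in> carrier G" for x
      using translation_matrix_expand[OF sys gh(2) lj(2), of "x \<otimes> g"] that gh
      by (simp add: \<rho>_def m_assoc)
    then have "\<rho> (g \<otimes> h) $$ (l, j) = inner_on (carrier G) (\<lambda>x. \<Sum>i<k. \<rho> h $$ (i, j) * e i (x \<otimes> g)) (e l)"
      unfolding entry[OF lj] inner_on_def by (intro sum.cong) auto
    also have "\<dots> = (\<Sum>i<k. \<rho> h $$ (i, j) * inner_on (carrier G) (\<lambda>x. e i (x \<otimes> g)) (e l))"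
      by (rule inner_on_sum_left)
    also have "\<dots> = (\<Sum>i<k. \<rho> g $$ (l, i) * \<rho> h $$ (i, j))"
      using lj by (intro sum.cong) (simp_all add: entry)
    also have "\<dots> = (\<rho> g * \<rho> h) $$ (l, j)"
      by (rule index_mult_mat_lessThan[OF rc rc lj, symmetric])
    finally show "\<rho> (g \<otimes> h) $$ (l, j) = (\<rho> g * \<rho> h) $$ (l, j)" .
  qed (use rc[of g] rc[of h] rc[of "g \<otimes> h"] in auto)
  have adj: "mat_adjoint (\<rho> g) = \<rho> (inv g)" if g: "g \<in> carrier G" for g
  proof (rule eq_matI)
    fix i j assume "i < dim_row (\<rho> (inv g))" "j < dim_col (\<rho> (inv g))"
    then have ij: "i < k" "j < k" using rc[of "inv g"] by auto
    have "\<rho> (inv g) $$ (i, j) = (\<Sum>x\<in>carrier G. e j (x \<otimes> inv g) * cnj (e i x))"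
      unfolding entry[OF ij] inner_on_def ..
    also have "\<dots> = (\<Sum>x\<in>carrier G. e j (x \<otimes> g \<otimes> inv g) * cnj (e i (x \<otimes> g)))"
      by (rule sum_right_translate[OF g, symmetric])
    also have "\<dots> = (\<Sum>x\<in>carrier G. e j x * cnj (e i (x \<otimes> g)))"
      using g by (intro sum.cong) (simp_all add: m_assoc)
    also have "\<dots> = cnj (\<rho> g $$ (j, i))"
      unfolding entry[OF ij(2,1)] inner_on_def by (simp add: mult.commute)
    finally show "mat_adjoint (\<rho> g) $$ (i, j) = \<rho> (inv g) $$ (i, j)"
      using index_mat_adjoint[OF rc ij] by simp
  qed (use rc[of "inv g"] mat_adjoint_carrier[OF rc[of g]] in \<open>auto simp del: mat_adjoint_carrier\<close>)
  have "\<rho> g * mat_adjoint (\<rho> g) = 1\<^sub>m k" if "g \<in> carrier G" for g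
    unfolding adj[OF that] using that by (simp flip: mult add: one)
  then show "unitary_rep G (translation_matrix k e)" "rep_degree G (translation_matrix k e) = k"
    using rc one mult deg unfolding unitary_rep_def \<rho>_def by simp_all
qed

text \<open>An invariant subspace of coordinate vectors has an orthonormal basis \<open>b\<close>, and the functions
  \<open>\<Sum>i. b s i * e i x\<close> form a translation system with as many members as \<open>b\<close>. Minimality of \<open>k\<close>
  leaves only the zero subspace and the whole space.\<close>

lemma translation_matrix_irreducible:
  assumes V: "linear_closed V" and sys: "translation_system V k e" and k: "k > 0"
    and min: "\<And>m e'. translation_system V m e' \<Longrightarrow> m > 0 \<Longrightarrow> k \<le> m"
  shows "irreducible_rep G (translation_matrix k e)"
  unfolding irreducible_rep_def translation_matrix_unitary_rep(2)[OF sys]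
proof (intro conjI allI impI translation_matrix_unitary_rep(1)[OF sys] k)
  define \<rho> where "\<rho> = translation_matrix k e"
  have rc: "\<rho> h \<in> carrier_mat k k" for h by (simp add: \<rho>_def translation_matrix_def)
  fix W
  assume "VectorSpace.subspace class_ring W (module_vec TYPE(complex) k) \<and>
    (\<forall>g\<in>carrier G. \<forall>w\<in>W. translation_matrix k e g *\<^sub>v w \<in> W)"
  then have W: "VectorSpace.subspace class_ring W (module_vec TYPE(complex) k)"
    and inv: "\<And>g w. g \<in> carrier G \<Longrightarrow> w \<in> W \<Longrightarrow> \<rho> g *\<^sub>v w \<in> W" by (auto simp: \<rho>_def)
  have sub: "W \<subseteq> carrier_vec k" and zero: "0\<^sub>v k \<in> W"
    using W unfolding VectorSpace.subspace_def submodule_def by (auto simp: module_vec_simps)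
  define U where "U = {u. \<exists>w\<in>W. \<forall>i<k. u i = w $ i}"
  have U: "linear_closed U" unfolding U_def by (rule mem_vec_subspace_closed[OF W])
  obtain m and b :: "nat \<Rightarrow> nat \<Rightarrow> complex" where b: "orthonormal_on {..<k} {..<m} b" "\<And>j. j < m \<Longrightarrow> b j \<in> U"
    and span: "\<And>v. v \<in> U \<Longrightarrow> \<exists>c. \<forall>x\<in>{..<k}. v x = (\<Sum>j<m. c j * b j x)"
    by (rule orthonormal_basis_exists[OF finite_lessThan[of k] U]) (rule that)
  have "m \<le> k" using orthonormal_card_le[OF _ _ b(1)] by simp
  then consider "m = 0" | "m = k" | "0 < m" "m < k" by linarith
  then show "W = {0\<^sub>v k} \<or> W = carrier_vec k"
  proof cases
    case 1
    have "w = 0\<^sub>v k" if w: "w \<in> W" for w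
    proof -
      have "(\<lambda>i. w $ i) \<in> U" using w by (auto simp: U_def)
      from span[OF this] have "\<forall>i<k. w $ i = 0" using 1 by auto
      then show ?thesis using w sub by (intro eq_vecI) auto
    qed
    then have "W \<subseteq> {0\<^sub>v k}" unfolding subset_eq singleton_iff by (rule ballI)
    with zero show ?thesis by blast
  next
    case 2
    have "v \<in> W" if v: "v \<in> carrier_vec k" for v
    proof -
      \<comment> \<open>The vector \<open>v\<close> is a combination of point masses, each of which is expanded in the basis \<open>b\<close>.\<close>
      have "(\<lambda>i. \<Sum>s<k. (\<Sum>j<k. v $ j * cnj (b s j)) * b s i) \<in> U"
        by (rule linear_closed_sum[OF U]) (use b(2) 2 in auto)
      then obtain w where w: "w \<in> W" "\<And>i. i < k \<Longrightarrow> (\<Sum>s<k. (\<Sum>j<k. v $ j * cnj (b s j)) * b s i) = w $ i"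
        by (auto simp: U_def)
      have "w $ i = v $ i" if i: "i < k" for i
      proof -
        have "w $ i = (\<Sum>j<k. \<Sum>s<k. v $ j * (cnj (b s j) * b s i))"
          unfolding w(2)[OF i, symmetric] sum_distrib_right by (subst sum.swap) (simp add: mult.assoc)
        also have "\<dots> = (\<Sum>j<k. if j = i then v $ j else 0)"
          unfolding sum_distrib_left[symmetric]
          using orthonormal_full_spans[OF _ _ b(1), of i] 2 i by (intro sum.cong) auto
        finally show ?thesis using i by simp
      qed
      then have "w = v" using v w(1) sub by (intro eq_vecI) auto
      with w show ?thesis by simp
    qed
    with sub show ?thesis by auto
  next
    case 3
    define e' where "e' s x = (\<Sum>i<k. b s i * e i x)" for s x
    have on: "inner_on (carrier G) (e i) (e j) = (if i = j then 1 else 0)" if "i < k" "j < k" for i j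
      using sys that by (auto simp: translation_system_def orthonormal_on_def)
    have ip: "inner_on (carrier G) (e i) (e' t) = cnj (b t i)" if i: "i < k" for i t
    proof -
      have "inner_on (carrier G) (e' t) (e i) = (\<Sum>j<k. b t j * inner_on (carrier G) (e j) (e i))"
        unfolding e'_def by (rule inner_on_sum_left)
      also have "\<dots> = (\<Sum>j<k. if j = i then b t j else 0)"
        using on i by (intro sum.cong) auto
      finally show ?thesis using i inner_on_commute[of _ "e i" "e' t"] by simp
    qed
    have "inner_on (carrier G) (e' s) (e' t) = inner_on {..<k} (b s) (b t)" for s t
    proof -
      have "inner_on (carrier G) (e' s) (e' t) = (\<Sum>i<k. b s i * inner_on (carrier G) (e i) (e' t))"
        unfolding e'_def[of s] by (rule inner_on_sum_left)
      then show ?thesis using ip by (simp add: inner_on_def)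
    qed
    then have "orthonormal_on (carrier G) {..<m} e'" using b(1) by (simp add: orthonormal_on_def)
    moreover have "e' s \<in> V" for s
      unfolding e'_def by (rule linear_closed_sum[OF V]) (use sys in \<open>auto simp: translation_system_def\<close>)
    moreover have "\<exists>c. \<forall>x\<in>carrier G. e' s (x \<otimes> h) = (\<Sum>t<m. c t * e' t x)"
      if h: "h \<in> carrier G" and s: "s < m" for h s
    proof -
      from b(2)[OF s] obtain w where w: "w \<in> W" "\<And>i. i < k \<Longrightarrow> b s i = w $ i" by (auto simp: U_def)
      have wk: "w \<in> carrier_vec k" using w(1) sub by auto
      have "(\<lambda>i. (\<rho> h *\<^sub>v w) $ i) \<in> U" using inv[OF h w(1)] by (auto simp: U_def)
      from span[OF this] obtain c where c: "\<And>i. i < k \<Longrightarrow> (\<rho> h *\<^sub>v w) $ i = (\<Sum>t<m. c t * b t i)" by auto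
      have "e' s (x \<otimes> h) = (\<Sum>t<m. c t * e' t x)" if x: "x \<in> carrier G" for x
      proof -
        have "e' s (x \<otimes> h) = (\<Sum>i<k. \<Sum>l<k. (\<rho> h $$ (l, i) * w $ i) * e l x)"
          unfolding e'_def using translation_matrix_expand[OF sys h _ x] w(2)
          by (intro sum.cong) (simp_all add: \<rho>_def sum_distrib_left mult_ac)
        also have "\<dots> = (\<Sum>l<k. (\<rho> h *\<^sub>v w) $ l * e l x)"
          unfolding sum_distrib_right[symmetric]
          by (subst sum.swap) (intro sum.cong refl, simp add: index_mult_mat_vec_lessThan[OF rc wk] sum_distrib_right)
        also have "\<dots> = (\<Sum>l<k. \<Sum>t<m. c t * (b t l * e l x))"
          using c by (intro sum.cong) (simp_all add: sum_distrib_right mult.assoc)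
        also have "\<dots> = (\<Sum>t<m. c t * e' t x)"
          by (subst sum.swap) (simp add: e'_def sum_distrib_left)
        finally show ?thesis .
      qed
      then show ?thesis by blast
    qed
    ultimately have "translation_system V m e'" unfolding translation_system_def by simp
    from min[OF this 3(1)] 3(2) show ?thesis by simp
  qed
qed

text \<open>The functions of this kind form the space in which a minimal translation system is sought; in the
  end only the zero function is left.\<close>

definition coefficient_orthogonal :: "('g \<Rightarrow> complex) \<Rightarrow> bool" where
  "coefficient_orthogonal v \<longleftrightarrow> (\<forall>\<rho>. irreducible_rep G \<rho> \<longrightarrow>
     (\<forall>i<rep_degree G \<rho>. \<forall>j<rep_degree G \<rho>. inner_on (carrier G) v (\<lambda>g. \<rho> g $$ (i, j)) = 0))"

lemma coefficient_orthogonal_closed: "linear_closed (Collect coefficient_orthogonal)"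
  unfolding linear_closed_def coefficient_orthogonal_def
  by (simp add: inner_on_add_left inner_on_scale_left) (simp add: inner_on_def)

lemma coefficient_orthogonal_translate:
  assumes v: "coefficient_orthogonal v" and h: "h \<in> carrier G"
  shows "coefficient_orthogonal (\<lambda>x. v (x \<otimes> h))"
  unfolding coefficient_orthogonal_def
proof (intro allI impI)
  fix \<rho> i j assume irr: "irreducible_rep G \<rho>" and ij: "i < rep_degree G \<rho>" "j < rep_degree G \<rho>"
  note un = irreducible_rep_unitary[OF irr]
  have hi: "inv h \<in> carrier G" using h by simp
  have "inner_on (carrier G) (\<lambda>x. v (x \<otimes> h)) (\<lambda>g. \<rho> g $$ (i, j))
     = (\<Sum>x\<in>carrier G. v (x \<otimes> inv h \<otimes> h) * cnj (\<rho> (x \<otimes> inv h) $$ (i, j)))"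
    unfolding inner_on_def by (rule sum_right_translate[OF hi, symmetric])
  also have "\<dots> = (\<Sum>x\<in>carrier G. \<Sum>k<rep_degree G \<rho>. cnj (\<rho> (inv h) $$ (k, j)) * (v x * cnj (\<rho> x $$ (i, k))))"
    using h rep_entry_mult[OF un _ hi ij]
    by (intro sum.cong) (simp_all add: m_assoc sum_distrib_left mult_ac)
  also have "\<dots> = (\<Sum>k<rep_degree G \<rho>. cnj (\<rho> (inv h) $$ (k, j)) * inner_on (carrier G) v (\<lambda>g. \<rho> g $$ (i, k)))"
    by (subst sum.swap) (simp add: inner_on_def sum_distrib_left)
  also have "\<dots> = 0" using v irr ij by (simp add: coefficient_orthogonal_def)
  finally show "inner_on (carrier G) (\<lambda>x. v (x \<otimes> h)) (\<lambda>g. \<rho> g $$ (i, j)) = 0" .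
qed

text \<open>Otherwise take a smallest translation system \<open>e\<close> of such functions. Evaluating the translation
  formula at the unit shows that \<open>e 0\<close> is a combination of coefficients of the irreducible
  representation that \<open>e\<close> carries, so \<open>e 0\<close> is orthogonal to itself.\<close>

lemma coefficient_orthogonal_zero:
  assumes "coefficient_orthogonal v" "x \<in> carrier G"
  shows "v x = 0"
proof (rule ccontr)
  assume vx: "v x \<noteq> 0"
  let ?V = "Collect coefficient_orthogonal"
  obtain k0 :: nat and e0 where e0: "orthonormal_on (carrier G) {..<k0} e0" "\<And>j. j < k0 \<Longrightarrow> e0 j \<in> ?V"
    "\<And>v. v \<in> ?V \<Longrightarrow> \<exists>c. \<forall>x\<in>carrier G. v x = (\<Sum>j<k0. c j * e0 j x)"
    by (rule orthonormal_basis_exists[OF finite_carrier coefficient_orthogonal_closed]) blast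
  have "k0 \<noteq> 0"
  proof
    assume "k0 = 0"
    with e0(3)[of v] assms vx show False by auto
  qed
  moreover have "translation_system ?V k0 e0"
    unfolding translation_system_def using e0 coefficient_orthogonal_translate by auto
  ultimately have ex: "\<exists>k. k > 0 \<and> (\<exists>e. translation_system ?V k e)" by blast
  define k where "k = (LEAST k. k > 0 \<and> (\<exists>e. translation_system ?V k e))"
  from LeastI_ex[OF ex] obtain e where k: "k > 0" and sys: "translation_system ?V k e"
    unfolding k_def by blast
  have min: "k \<le> m" if "translation_system ?V m e'" "m > 0" for m e'
    unfolding k_def by (rule Least_le) (use that in blast)
  define \<rho> where "\<rho> = translation_matrix k e"
  have irr: "irreducible_rep G \<rho>" unfolding \<rho>_def
    by (rule translation_matrix_irreducible[OF coefficient_orthogonal_closed sys k min])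
  have deg: "rep_degree G \<rho> = k" unfolding \<rho>_def by (rule translation_matrix_unitary_rep(2)[OF sys])
  have e0V: "coefficient_orthogonal (e 0)" using sys k by (simp add: translation_system_def)
  have "e 0 g = (\<Sum>i<k. e i \<one> * \<rho> g $$ (i, 0))" if "g \<in> carrier G" for g
    using translation_matrix_expand[OF sys that k one_closed] that by (simp add: \<rho>_def mult.commute)
  then have "inner_on (carrier G) (e 0) (e 0)
      = inner_on (carrier G) (\<lambda>g. \<Sum>i<k. e i \<one> * \<rho> g $$ (i, 0)) (e 0)"
    by (simp add: inner_on_def)
  also have "\<dots> = (\<Sum>i<k. e i \<one> * inner_on (carrier G) (\<lambda>g. \<rho> g $$ (i, 0)) (e 0))"
    by (rule inner_on_sum_left)
  also have "\<dots> = 0"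
    using e0V irr deg k inner_on_commute[of _ _ "e 0"] by (simp add: coefficient_orthogonal_def)
  finally show False using sys k by (simp add: translation_system_def orthonormal_on_def)
qed

lemma sum_conjugate:
  "h \<in> carrier G \<Longrightarrow> (\<Sum>g\<in>carrier G. f (h \<otimes> g \<otimes> inv h)) = (\<Sum>g\<in>carrier G. f g)"
  using sum_left_translate[of h "\<lambda>g. f (g \<otimes> inv h)"] sum_right_translate[of "inv h" f] by simp

text \<open>Since \<open>f\<close> is a class function, the matrix \<open>\<Sum>g. cnj (f g) * \<rho> g\<close> commutes with \<open>\<rho>\<close>. It is then a
  scalar, whose trace is the conjugate of the inner product of \<open>f\<close> and the character. So \<open>f\<close> is
  orthogonal to all coefficients as soon as it is orthogonal to all irreducible characters.\<close>

lemma class_function_zero: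
  assumes f: "f \<in> class_functions G"
    and orth: "\<And>\<rho>. irreducible_rep G \<rho> \<Longrightarrow> inner_on (carrier G) f (rep_character \<rho>) = 0"
  shows "f = (\<lambda>g. 0)"
proof -
  have "coefficient_orthogonal f"
    unfolding coefficient_orthogonal_def
  proof (intro allI impI)
    fix \<rho> i j assume irr: "irreducible_rep G \<rho>" and ij: "i < rep_degree G \<rho>" "j < rep_degree G \<rho>"
    define d where "d = rep_degree G \<rho>"
    note un = irreducible_rep_unitary[OF irr]
    define S where "S = mat d d (\<lambda>(i, j). \<Sum>g\<in>carrier G. cnj (f g) * \<rho> g $$ (i, j))"
    have Sc: "S \<in> carrier_mat d d" by (simp add: S_def)
    have comm: "S * \<rho> h = \<rho> h * S" if h: "h \<in> carrier G" for h
    proof (rule eq_matI)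
      have rc: "\<rho> h \<in> carrier_mat d d" using unitary_rep_carrier[OF un h] by (simp add: d_def)
      fix i j assume "i < dim_row (\<rho> h * S)" "j < dim_col (\<rho> h * S)"
      then have ij: "i < d" "j < d" using rc Sc by auto
      have "(S * \<rho> h) $$ (i, j) = (\<Sum>k<d. \<Sum>g\<in>carrier G. cnj (f g) * (\<rho> g $$ (i, k) * \<rho> h $$ (k, j)))"
        unfolding index_mult_mat_lessThan[OF Sc rc ij]
        using ij by (intro sum.cong) (simp_all add: S_def sum_distrib_right mult.assoc)
      also have "\<dots> = (\<Sum>g\<in>carrier G. cnj (f g) * \<rho> (g \<otimes> h) $$ (i, j))"
        using rep_entry_mult[OF un _ h] ij
        by (subst sum.swap) (intro sum.cong, simp_all add: d_def sum_distrib_left)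
      also have "\<dots> = (\<Sum>g\<in>carrier G. cnj (f (h \<otimes> g \<otimes> inv h)) * \<rho> (h \<otimes> g \<otimes> inv h \<otimes> h) $$ (i, j))"
        by (rule sum_conjugate[OF h, symmetric])
      also have "\<dots> = (\<Sum>g\<in>carrier G. cnj (f g) * \<rho> (h \<otimes> g) $$ (i, j))"
      proof (intro sum.cong refl)
        fix g assume g: "g \<in> carrier G"
        have "h \<otimes> g \<otimes> inv h \<otimes> h = h \<otimes> g" using g h by (simp add: m_assoc)
        moreover have "f (h \<otimes> g \<otimes> inv h) = f g" using f g h by (simp add: class_functions_def)
        ultimately show "cnj (f (h \<otimes> g \<otimes> inv h)) * \<rho> (h \<otimes> g \<otimes> inv h \<otimes> h) $$ (i, j)
            = cnj (f g) * \<rho> (h \<otimes> g) $$ (i, j)" by simp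
      qed
      also have "\<dots> = (\<Sum>k<d. \<Sum>g\<in>carrier G. \<rho> h $$ (i, k) * (cnj (f g) * \<rho> g $$ (k, j)))"
        using rep_entry_mult[OF un h] ij
        by (subst sum.swap) (intro sum.cong, simp_all add: d_def sum_distrib_left mult_ac)
      also have "\<dots> = (\<rho> h * S) $$ (i, j)"
        unfolding index_mult_mat_lessThan[OF rc Sc ij]
        using ij by (intro sum.cong) (simp_all add: S_def sum_distrib_left)
      finally show "(S * \<rho> h) $$ (i, j) = (\<rho> h * S) $$ (i, j)" .
    qed (use carrier_matD[OF unitary_rep_carrier[OF un h]] carrier_matD[OF Sc] in \<open>simp_all add: d_def\<close>)
    obtain c where c: "S = c \<cdot>\<^sub>m 1\<^sub>m d"
      by (rule schur_commutant[OF irr Sc[unfolded d_def] comm]) (use that in \<open>simp_all add: d_def\<close>)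
    have "of_nat d * c = (\<Sum>i<d. S $$ (i, i))" unfolding c by simp
    also have "\<dots> = (\<Sum>g\<in>carrier G. cnj (f g) * rep_character \<rho> g)"
      by (subst rep_character_def) (simp add: S_def sum_distrib_left d_def[symmetric] sum.swap[of _ _ "carrier G"])
    also have "\<dots> = cnj (inner_on (carrier G) f (rep_character \<rho>))"
      by (simp add: inner_on_def)
    finally have "c = 0" using orth[OF irr] irreducible_rep_degree_pos[OF irr] by (simp add: d_def)
    then have S0: "S $$ (i, j) = 0" unfolding c using ij by (simp add: d_def)
    have "inner_on (carrier G) f (\<lambda>g. \<rho> g $$ (i, j)) = cnj (S $$ (i, j))"
      using ij unfolding S_def d_def inner_on_def by simp
    then show "inner_on (carrier G) f (\<lambda>g. \<rho> g $$ (i, j)) = 0" unfolding S0 by simp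
  qed
  from coefficient_orthogonal_zero[OF this] have "f g = 0" if "g \<in> carrier G" for g using that .
  moreover have "f g = 0" if "g \<notin> carrier G" for g using f that by (simp add: class_functions_def)
  ultimately show ?thesis by blast
qed

section \<open>The unitary dual and the Fourier norm\<close>

lemma card_carrier_pos: "card (carrier G) > 0"
  using finite_carrier one_closed card_gt_0_iff by blast

lemma rep_equivalence_equiv: "equiv {\<rho>. irreducible_rep G \<rho>} (rep_equivalence G)"
proof (rule equivI)
  show "rep_equivalence G \<subseteq> {\<rho>. irreducible_rep G \<rho>} \<times> {\<rho>. irreducible_rep G \<rho>}"
    by (auto simp: rep_equivalence_def)
  show "refl_on {\<rho>. irreducible_rep G \<rho>} (rep_equivalence G)"
  proof (rule refl_onI)
    fix \<rho> assume "\<rho> \<in> {\<rho>. irreducible_rep G \<rho>}"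
    then have irr: "irreducible_rep G \<rho>" by simp
    have "invertible_mat (1\<^sub>m (rep_degree G \<rho>) :: complex mat)"
      by (rule invertible_matI[of _ "rep_degree G \<rho>" "1\<^sub>m (rep_degree G \<rho>)"]) auto
    moreover have "1\<^sub>m (rep_degree G \<rho>) * \<rho> g = \<rho> g * 1\<^sub>m (rep_degree G \<rho>)" if "g \<in> carrier G" for g
      using unitary_rep_carrier[OF irreducible_rep_unitary[OF irr] that] by simp
    ultimately show "(\<rho>, \<rho>) \<in> rep_equivalence G"
      using irr unfolding rep_equivalence_def by (auto intro!: bexI[of _ "1\<^sub>m (rep_degree G \<rho>)"])
  qed
  show "sym (rep_equivalence G)"
  proof (rule symI)
    fix \<rho> \<sigma> assume "(\<rho>, \<sigma>) \<in> rep_equivalence G"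
    then obtain P where irr: "irreducible_rep G \<rho>" "irreducible_rep G \<sigma>"
      and deg: "rep_degree G \<rho> = rep_degree G \<sigma>"
      and P: "P \<in> carrier_mat (rep_degree G \<rho>) (rep_degree G \<rho>)" "invertible_mat P"
      and int: "\<And>g. g \<in> carrier G \<Longrightarrow> P * \<rho> g = \<sigma> g * P"
      unfolding rep_equivalence_def by blast
    define d where "d = rep_degree G \<sigma>"
    have Pc: "P \<in> carrier_mat d d" using P deg by (simp add: d_def)
    obtain Q where Qc: "Q \<in> carrier_mat d d" and PQ1: "P * Q = 1\<^sub>m d" and QP1: "Q * P = 1\<^sub>m d"
      by (rule invertible_matE[OF P(2) Pc])
    have "Q * \<sigma> g = \<rho> g * Q" if g: "g \<in> carrier G" for g
    proof -
      have rc: "\<rho> g \<in> carrier_mat d d" "\<sigma> g \<in> carrier_mat d d"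
        using unitary_rep_carrier[OF irr(1)[THEN irreducible_rep_unitary] g]
          unitary_rep_carrier[OF irr(2)[THEN irreducible_rep_unitary] g] deg by (simp_all add: d_def)
      have "Q * \<sigma> g = Q * (\<sigma> g * (P * Q))" unfolding PQ1 using rc by simp
      also have "\<sigma> g * (P * Q) = (\<sigma> g * P) * Q" by (rule assoc_mult_mat[symmetric, OF rc(2) Pc Qc])
      also have "\<dots> = P * (\<rho> g * Q)" unfolding int[OF g, symmetric] by (rule assoc_mult_mat[OF Pc rc(1) Qc])
      also have "Q * (P * (\<rho> g * Q)) = (Q * P) * (\<rho> g * Q)"
        by (rule assoc_mult_mat[symmetric, OF Qc Pc mult_carrier_mat[OF rc(1) Qc]])
      also have "\<dots> = \<rho> g * Q" unfolding QP1 by (rule left_mult_one_mat[OF mult_carrier_mat[OF rc(1) Qc]])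
      finally show ?thesis .
    qed
    moreover have "invertible_mat Q"
      by (rule invertible_matI[OF Qc Pc QP1 PQ1])
    ultimately show "(\<sigma>, \<rho>) \<in> rep_equivalence G"
      using irr deg Qc unfolding rep_equivalence_def d_def by auto
  qed
  show "trans (rep_equivalence G)"
  proof (rule transI)
    fix \<rho> \<sigma> \<tau> assume "(\<rho>, \<sigma>) \<in> rep_equivalence G" "(\<sigma>, \<tau>) \<in> rep_equivalence G"
    then obtain P Q where irr: "irreducible_rep G \<rho>" "irreducible_rep G \<sigma>" "irreducible_rep G \<tau>"
      and deg: "rep_degree G \<rho> = rep_degree G \<sigma>" "rep_degree G \<sigma> = rep_degree G \<tau>"
      and P: "P \<in> carrier_mat (rep_degree G \<rho>) (rep_degree G \<rho>)" "invertible_mat P"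
      and Q: "Q \<in> carrier_mat (rep_degree G \<sigma>) (rep_degree G \<sigma>)" "invertible_mat Q"
      and int: "\<And>g. g \<in> carrier G \<Longrightarrow> P * \<rho> g = \<sigma> g * P"
        "\<And>g. g \<in> carrier G \<Longrightarrow> Q * \<sigma> g = \<tau> g * Q"
      unfolding rep_equivalence_def by blast
    define d where "d = rep_degree G \<rho>"
    have Pc: "P \<in> carrier_mat d d" and Qc: "Q \<in> carrier_mat d d" using P Q deg by (simp_all add: d_def)
    have "(Q * P) * \<rho> g = \<tau> g * (Q * P)" if g: "g \<in> carrier G" for g
    proof -
      have rc: "\<rho> g \<in> carrier_mat d d" "\<sigma> g \<in> carrier_mat d d" "\<tau> g \<in> carrier_mat d d"
        using irr[THEN irreducible_rep_unitary, THEN unitary_rep_carrier, OF g] deg by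
            (simp_all add: d_def)
      have "(Q * P) * \<rho> g = Q * (\<sigma> g * P)"
        unfolding int(1)[OF g, symmetric] by (rule assoc_mult_mat[OF Qc Pc rc(1)])
      also have "\<dots> = (\<tau> g * Q) * P"
        unfolding int(2)[OF g, symmetric] by (rule assoc_mult_mat[symmetric, OF Qc rc(2) Pc])
      also have "\<dots> = \<tau> g * (Q * P)" by (rule assoc_mult_mat[OF rc(3) Qc Pc])
      finally show ?thesis .
    qed
    moreover have "invertible_mat (Q * P)"
      by (rule invertible_mat_mult[OF Q(2) Qc P(2) Pc])
    ultimately show "(\<rho>, \<tau>) \<in> rep_equivalence G"
      using irr deg Pc Qc unfolding rep_equivalence_def d_def by auto
  qed
qed

definition dual_rep :: "('g \<Rightarrow> complex mat) set \<Rightarrow> 'g \<Rightarrow> complex mat" where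
  "dual_rep \<pi> = (SOME \<rho>. \<rho> \<in> \<pi>)"

lemma dual_rep_mem: "\<pi> \<in> unitary_dual G \<Longrightarrow> dual_rep \<pi> \<in> \<pi>"
  unfolding dual_rep_def unitary_dual_def some_in_eq
  by (rule in_quotient_imp_non_empty[OF rep_equivalence_equiv])

lemma dual_rep_irreducible:
  assumes "\<pi> \<in> unitary_dual G"
  shows "irreducible_rep G (dual_rep \<pi>)"
  using subsetD[OF in_quotient_imp_subset[OF rep_equivalence_equiv assms[unfolded unitary_dual_def]]
      dual_rep_mem[OF assms]] by simp

lemma dual_rep_unitary: "\<pi> \<in> unitary_dual G \<Longrightarrow> unitary_rep G (dual_rep \<pi>)"
  by (intro irreducible_rep_unitary dual_rep_irreducible)

lemma dual_rep_inequivalent: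
  assumes "\<pi> \<in> unitary_dual G" "\<sigma> \<in> unitary_dual G" "(dual_rep \<pi>, dual_rep \<sigma>) \<in> rep_equivalence G"
  shows "\<pi> = \<sigma>"
  by (rule quotient_eqI[OF rep_equivalence_equiv assms(1,2)[unfolded unitary_dual_def]
      dual_rep_mem[OF assms(1)] dual_rep_mem[OF assms(2)] assms(3)])

lemma dual_rep_exists:
  assumes "irreducible_rep G \<rho>"
  obtains \<pi> where "\<pi> \<in> unitary_dual G" "(\<rho>, dual_rep \<pi>) \<in> rep_equivalence G"
proof
  let ?\<pi> = "rep_equivalence G `` {\<rho>}"
  show "?\<pi> \<in> unitary_dual G" using assms by (auto simp: unitary_dual_def intro: quotientI)
  from dual_rep_mem[OF this] show "(\<rho>, dual_rep ?\<pi>) \<in> rep_equivalence G" by simp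
qed

lemma degree_of_eq: "degree_of G \<pi> = rep_degree G (dual_rep \<pi>)"
  by (simp add: degree_of_def dual_rep_def)

lemma character_of_eq: "g \<in> carrier G \<Longrightarrow> character_of G \<pi> g = rep_character (dual_rep \<pi>) g"
  by (simp add: character_of_def degree_of_eq rep_character_def) (simp add: dual_rep_def)

lemma class_functions_closed: "linear_closed (class_functions G)"
  by (simp add: linear_closed_def class_functions_def)

lemma character_of_class_function:
  assumes "\<pi> \<in> unitary_dual G"
  shows "character_of G \<pi> \<in> class_functions G"
  using rep_character_conj[OF dual_rep_unitary[OF assms]]
  by (simp add: class_functions_def character_of_eq) (simp add: character_of_def)

lemma inner_character_of:
  assumes "\<pi> \<in> unitary_dual G" "\<sigma> \<in> unitary_dual G"
  shows "inner_on (carrier G) (character_of G \<pi>) (character_of G \<sigma>)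
       = (if \<pi> = \<sigma> then of_nat (card (carrier G)) else 0)"
proof -
  have "inner_on (carrier G) (character_of G \<pi>) (character_of G \<sigma>)
      = inner_on (carrier G) (rep_character (dual_rep \<pi>)) (rep_character (dual_rep \<sigma>))"
    by (simp add: inner_on_def character_of_eq)
  then show ?thesis
    using rep_character_norm[OF dual_rep_irreducible[OF assms(1)]] dual_rep_inequivalent[OF assms(2,1)]
      rep_character_orthogonal[OF dual_rep_irreducible[OF assms(2)] dual_rep_irreducible[OF assms(1)]]
    by auto
qed

text \<open>The normalised characters are orthonormal, so there are at most as many as elements of the group.\<close>

lemma finite_unitary_dual: "finite (unitary_dual G)"
proof (rule ccontr)
  let ?n = "card (carrier G)"
  assume "infinite (unitary_dual G)"
  then obtain S where S: "S \<subseteq> unitary_dual G" "finite S" "card S = Suc ?n"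
    using infinite_arbitrarily_large by blast
  define e where "e \<pi> g = complex_of_real (1 / sqrt ?n) * character_of G \<pi> g" for \<pi> g
  have n: "complex_of_real (1 / sqrt ?n) * (complex_of_real (1 / sqrt ?n) * of_nat ?n) = 1"
  proof -
    have "(1 / sqrt ?n) * ((1 / sqrt ?n) * real ?n) = 1"
      using card_carrier_pos by (simp add: field_simps)
    from arg_cong[OF this, of complex_of_real] show ?thesis
      by (simp only: of_real_mult of_real_of_nat_eq of_real_1)
  qed
  have "inner_on (carrier G) (e \<pi>) (e \<sigma>) = (if \<pi> = \<sigma> then 1 else 0)" if "\<pi> \<in> S" "\<sigma> \<in> S" for \<pi> \<sigma>
  proof -
    have "inner_on (carrier G) (e \<pi>) (e \<sigma>) = complex_of_real (1 / sqrt ?n) *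
        (complex_of_real (1 / sqrt ?n) * inner_on (carrier G) (character_of G \<pi>) (character_of G \<sigma>))"
      unfolding inner_on_def e_def sum_distrib_left by (intro sum.cong) (simp_all add: mult_ac)
    also have "inner_on (carrier G) (character_of G \<pi>) (character_of G \<sigma>)
        = (if \<pi> = \<sigma> then of_nat ?n else 0)"
      using that S(1) by (intro inner_character_of) auto
    finally show ?thesis using n by (cases "\<pi> = \<sigma>") (simp_all only: refl if_True if_False mult_zero_right)
  qed
  then have "orthonormal_on (carrier G) S e" by (simp add: orthonormal_on_def)
  from orthonormal_card_le[OF finite_carrier S(2) this] S(3) show False by simp
qed

definition fourier_coeff :: "('g \<Rightarrow> complex) \<Rightarrow> ('g \<Rightarrow> complex mat) set \<Rightarrow> complex" where
  "fourier_coeff f \<pi> = inner_on (carrier G) f (character_of G \<pi>) / of_nat (card (carrier G))"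

lemma fourier_coeff_sum:
  assumes "\<sigma> \<in> unitary_dual G"
  shows "fourier_coeff (\<lambda>g. \<Sum>\<pi>\<in>unitary_dual G. \<alpha> \<pi> * character_of G \<pi> g) \<sigma> = \<alpha> \<sigma>"
proof -
  have "(\<Sum>\<pi>\<in>unitary_dual G. \<alpha> \<pi> * inner_on (carrier G) (character_of G \<pi>) (character_of G \<sigma>))
      = (\<Sum>\<pi>\<in>unitary_dual G. if \<pi> = \<sigma> then \<alpha> \<pi> * of_nat (card (carrier G)) else 0)"
    using assms by (intro sum.cong) (auto simp: inner_character_of)
  then show ?thesis
    using assms finite_unitary_dual card_carrier_pos
    by (simp add: fourier_coeff_def inner_on_sum_left)
qed

lemma fourier_expansion:
  assumes f: "f \<in> class_functions G"
  shows "f = (\<lambda>g. \<Sum>\<pi>\<in>unitary_dual G. fourier_coeff f \<pi> * character_of G \<pi> g)"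
proof -
  define p where "p = (\<lambda>g. \<Sum>\<pi>\<in>unitary_dual G. fourier_coeff f \<pi> * character_of G \<pi> g)"
  have "p \<in> class_functions G"
    unfolding p_def using character_of_class_function
    by (intro linear_closed_sum[OF class_functions_closed finite_unitary_dual])
  then have "(\<lambda>g. f g - p g) \<in> class_functions G"
    using f by (simp add: class_functions_def)
  moreover have "inner_on (carrier G) (\<lambda>g. f g - p g) (rep_character \<rho>)
      = 0" if irr: "irreducible_rep G \<rho>" for \<rho>
  proof -
    obtain \<pi> where \<pi>: "\<pi> \<in> unitary_dual G" "(\<rho>, dual_rep \<pi>) \<in> rep_equivalence G"
      by (rule dual_rep_exists[OF irr])
    have "inner_on (carrier G) h (rep_character \<rho>) = inner_on (carrier G) h (character_of G \<pi>)" for h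
      using rep_equivalence_character[OF \<pi>(2)] by (simp add: inner_on_def character_of_eq)
    moreover have "inner_on (carrier G) p (character_of G \<pi>) = inner_on (carrier G) f (character_of G \<pi>)"
      using fourier_coeff_sum[OF \<pi>(1), of "fourier_coeff f"] card_carrier_pos
      unfolding p_def[symmetric] by (simp add: fourier_coeff_def)
    ultimately show ?thesis by (simp add: inner_on_diff_left)
  qed
  ultimately have "(\<lambda>g. f g - p g) = (\<lambda>g. 0)" by (rule class_function_zero)
  then have "f = p" using fun_cong[of "\<lambda>g. f g - p g" "\<lambda>g. 0"] by (intro ext) simp
  then show ?thesis by (simp only: p_def)
qed

text \<open>The definite description in the definition of the norm is met: the expansion exists, and
  orthogonality determines its coefficients.\<close>

lemma fourier_norm_eq:
  assumes f: "f \<in> class_functions G"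
  shows "fourier_norm G f = (\<Sum>\<pi>\<in>unitary_dual G. real (degree_of G \<pi>) * cmod (fourier_coeff f \<pi>))"
  unfolding fourier_norm_def
proof (rule the_equality)
  show "\<exists>\<alpha>. f = (\<lambda>g. \<Sum>\<pi>\<in>unitary_dual G. \<alpha> \<pi> * character_of G \<pi> g) \<and>
      (\<Sum>\<pi>\<in>unitary_dual G. real (degree_of G \<pi>) * cmod (fourier_coeff f \<pi>)) =
      (\<Sum>\<pi>\<in>unitary_dual G. real (degree_of G \<pi>) * cmod (\<alpha> \<pi>))"
    using fourier_expansion[OF f] by (intro exI[of _ "fourier_coeff f"] conjI refl)
next
  fix r assume "\<exists>\<alpha>. f = (\<lambda>g. \<Sum>\<pi>\<in>unitary_dual G. \<alpha> \<pi> * character_of G \<pi> g) \<and>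
      r = (\<Sum>\<pi>\<in>unitary_dual G. real (degree_of G \<pi>) * cmod (\<alpha> \<pi>))"
  then obtain \<alpha> where \<alpha>: "f = (\<lambda>g. \<Sum>\<pi>\<in>unitary_dual G. \<alpha> \<pi> * character_of G \<pi> g)"
    "r = (\<Sum>\<pi>\<in>unitary_dual G. real (degree_of G \<pi>) * cmod (\<alpha> \<pi>))" by blast
  have "fourier_coeff f \<pi> = \<alpha> \<pi>" if "\<pi> \<in> unitary_dual G" for \<pi>
    unfolding \<alpha>(1) by (rule fourier_coeff_sum[OF that])
  then show "r = (\<Sum>\<pi>\<in>unitary_dual G. real (degree_of G \<pi>) * cmod (fourier_coeff f \<pi>))"
    unfolding \<alpha>(2) by (intro sum.cong) auto
qed

lemma fourier_norm_nonneg: "f \<in> class_functions G \<Longrightarrow> fourier_norm G f \<ge> 0"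
  by (simp add: fourier_norm_eq sum_nonneg)

lemma fourier_norm_uminus:
  assumes f: "f \<in> class_functions G"
  shows "fourier_norm G (\<lambda>x. - 1 * f x) = fourier_norm G f"
proof -
  have "(\<lambda>x. - 1 * f x) \<in> class_functions G" using f by (simp add: class_functions_def)
  moreover have "fourier_coeff (\<lambda>x. - 1 * f x) \<pi> = - 1 * fourier_coeff f \<pi>" for \<pi>
    unfolding fourier_coeff_def inner_on_scale_left by (simp only: times_divide_eq_right)
  ultimately show ?thesis by (simp only: fourier_norm_eq[OF f] fourier_norm_eq norm_mult) simp
qed

text \<open>All norms on the class functions are equivalent. This direction is used to see that
  multiplication is bounded and that pointwise convergence implies convergence in norm.\<close>

lemma fourier_norm_bounded_by_sup:
  obtains K where "\<And>f B. f \<in> class_functions G \<Longrightarrow> (\<And>g. g \<in> carrier G \<Longrightarrow> cmod (f g) \<le> B) \<Longrightarrow>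
    fourier_norm G f \<le> K * B"
proof
  define L where "L \<pi> = (\<Sum>g\<in>carrier G. cmod (character_of G \<pi> g)) / card (carrier G)" for \<pi>
  fix f B assume f: "f \<in> class_functions G" and B: "\<And>g. g \<in> carrier G \<Longrightarrow> cmod (f g) \<le> B"
  have "cmod (fourier_coeff f \<pi>) \<le> L \<pi> * B" for \<pi>
  proof -
    have "cmod (inner_on (carrier G) f (character_of G \<pi>))
        \<le> (\<Sum>g\<in>carrier G. cmod (f g) * cmod (character_of G \<pi> g))"
      unfolding inner_on_def by (rule order_trans[OF norm_sum]) (simp add: norm_mult)
    also have "\<dots> \<le> (\<Sum>g\<in>carrier G. B * cmod (character_of G \<pi> g))"
      using B by (intro sum_mono mult_right_mono) auto
    finally show ?thesis
      unfolding fourier_coeff_def L_def by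
          (simp add: norm_divide divide_right_mono sum_distrib_left mult.commute)
  qed
  then show "fourier_norm G f \<le> (\<Sum>\<pi>\<in>unitary_dual G. degree_of G \<pi> * L \<pi>) * B"
    unfolding fourier_norm_eq[OF f] sum_distrib_right mult.assoc by (intro sum_mono mult_left_mono) auto
qed

lemma cmod_le_fourier_norm:
  assumes f: "f \<in> class_functions G" and g: "g \<in> carrier G"
  shows "cmod (f g) \<le> fourier_norm G f"
proof -
  have char: "cmod (character_of G \<pi> g) \<le> degree_of G \<pi>" if \<pi>: "\<pi> \<in> unitary_dual G" for \<pi>
  proof -
    let ?\<rho> = "dual_rep \<pi>"
    note un = dual_rep_unitary[OF \<pi>]
    have "cmod (?\<rho> g $$ (i, i)) \<le> 1" if i: "i < rep_degree G ?\<rho>" for i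
    proof -
      have "complex_of_real (\<Sum>k<rep_degree G ?\<rho>. (cmod (?\<rho> g $$ (k, i)))\<^sup>2) = 1"
        unfolding of_real_sum complex_norm_square
        using rep_column_orthonormal[OF un g i i] by (simp add: mult.commute)
      then have "(\<Sum>k<rep_degree G ?\<rho>. (cmod (?\<rho> g $$ (k, i)))\<^sup>2) = 1" by (simp only: of_real_eq_1_iff)
      moreover have "(cmod (?\<rho> g $$ (i, i)))\<^sup>2 \<le> (\<Sum>k<rep_degree G ?\<rho>. (cmod (?\<rho> g $$ (k, i)))\<^sup>2)"
        using i by (intro member_le_sum) auto
      ultimately show ?thesis by (simp add: power2_le_imp_le abs_square_le_1)
    qed
    then have "cmod (rep_character ?\<rho> g) \<le> (\<Sum>i<rep_degree G ?\<rho>. 1)"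
      unfolding rep_character_def by (intro order_trans[OF norm_sum] sum_mono) auto
    then show ?thesis using g by (simp add: character_of_eq degree_of_eq)
  qed
  have "cmod (f g) = cmod (\<Sum>\<pi>\<in>unitary_dual G. fourier_coeff f \<pi> * character_of G \<pi> g)"
    by (subst fourier_expansion[OF f]) simp
  also have "\<dots> \<le> (\<Sum>\<pi>\<in>unitary_dual G. degree_of G \<pi> * cmod (fourier_coeff f \<pi>))"
    by (intro order_trans[OF norm_sum] sum_mono)
      (use char in \<open>simp add: norm_mult mult.commute[of "real _"] mult_right_mono mult_left_mono\<close>)
  finally show ?thesis by (simp add: fourier_norm_eq[OF f])
qed

end

section \<open>The three-ones pattern\<close>

text \<open>The left-hand side is at most \<open>\<bar>x1\<bar> u + \<bar>x2\<bar> v\<close> with \<open>u = \<bar>2 y1 + 2 y2\<bar>\<close> and \<open>v = \<bar>2 y1 - y2\<bar>\<close>. In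
  \<open>u\<^sup>2 + 2 v\<^sup>2\<close> the inner product of \<open>y1\<close> and \<open>y2\<close> cancels. The inequality of arithmetic and geometric
  means is applied with the weights \<open>2 * sqrt 3\<close> and \<open>sqrt 3\<close>, the values of \<open>u\<close> and \<open>v\<close> in the
  extremal configuration of unit vectors.\<close>

lemma three_ones_pointwise:
  fixes x1 x2 y1 y2 :: complex
  shows "cmod (cnj x1 * (2 * y1 + 2 * y2) + cnj x2 * (2 * y1 - y2))
    \<le> sqrt 3 * (cmod x1)\<^sup>2 + sqrt 3 / 2 * (cmod x2)\<^sup>2 + sqrt 3 * (cmod y1)\<^sup>2 + sqrt 3 / 2 * (cmod y2)\<^sup>2"
proof -
  define u v where "u = cmod (2 * y1 + 2 * y2)" and "v = cmod (2 * y1 - y2)"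
  have amgm: "a * b \<le> c / 2 * a\<^sup>2 + b\<^sup>2 / (2 * c)" if "c > 0" for a b c :: real
  proof -
    have "2 * c * (c / 2 * a\<^sup>2 + b\<^sup>2 / (2 * c)) - 2 * c * (a * b) = (c * a - b)\<^sup>2"
      using that by (simp add: power2_eq_square algebra_simps)
    then have "2 * c * (a * b) \<le> 2 * c * (c / 2 * a\<^sup>2 + b\<^sup>2 / (2 * c))"
      using zero_le_power2[of "c * a - b"] by linarith
    then show ?thesis using that by (simp only: mult_le_cancel_left_pos)
  qed
  have split: "a / (2 * (2 * r)) + b / (2 * r) = (a + 2 * b) / (4 * r)"
    and split': "(12 * a + 6 * b) / (4 * r) = 3 / r * a + 3 / r / 2 * b" for a b r :: real
    by (simp_all add: add_divide_distrib)
  have r: "3 / sqrt 3 = sqrt 3" by (rule real_div_sqrt) simp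
  have uv: "u\<^sup>2 + 2 * v\<^sup>2 = 12 * (cmod y1)\<^sup>2 + 6 * (cmod y2)\<^sup>2"
    unfolding u_def v_def cmod_power2 by (simp add: power2_eq_square algebra_simps)
  have "cmod (cnj x1 * (2 * y1 + 2 * y2) + cnj x2 * (2 * y1 - y2)) \<le> cmod x1 * u + cmod x2 * v"
    unfolding u_def v_def by (rule order_trans[OF norm_triangle_ineq]) (simp add: norm_mult)
  also have "\<dots> \<le> (2 * sqrt 3 / 2 * (cmod x1)\<^sup>2 + u\<^sup>2 / (2 * (2 * sqrt 3)))
               + (sqrt 3 / 2 * (cmod x2)\<^sup>2 + v\<^sup>2 / (2 * sqrt 3))"
    by (intro add_mono amgm) auto
  also have "\<dots> = sqrt 3 * (cmod x1)\<^sup>2 + sqrt 3 / 2 * (cmod x2)\<^sup>2 + (u\<^sup>2 + 2 * v\<^sup>2) / (4 * sqrt 3)"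
    using split[of "u\<^sup>2" "sqrt 3" "v\<^sup>2"] by linarith
  also have "(u\<^sup>2 + 2 * v\<^sup>2) / (4 * sqrt 3) = 3 / sqrt 3 * (cmod y1)\<^sup>2 + 3 / sqrt 3 / 2 * (cmod y2)\<^sup>2"
    unfolding uv by (rule split')
  also have "\<dots> = sqrt 3 * (cmod y1)\<^sup>2 + sqrt 3 / 2 * (cmod y2)\<^sup>2" unfolding r ..
  finally show ?thesis by (simp only: add.assoc)
qed

text \<open>The weights \<open>[[2, 2], [2, -1]]\<close> have trace pairing \<open>6\<close> with the matrix \<open>[[1, 1], [1, 0]]\<close> but at most
  \<open>3 * sqrt 3\<close> with a matrix of inner products of vectors in the unit ball. The quotient of the two
  numbers is \<open>2 / sqrt 3\<close>.\<close>

lemma three_ones_inequality: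
  fixes x1 x2 y1 y2 :: "'i \<Rightarrow> complex"
  assumes "(\<Sum>i\<in>I. (cmod (x1 i))\<^sup>2) \<le> 1" "(\<Sum>i\<in>I. (cmod (x2 i))\<^sup>2) \<le> 1"
    "(\<Sum>i\<in>I. (cmod (y1 i))\<^sup>2) \<le> 1" "(\<Sum>i\<in>I. (cmod (y2 i))\<^sup>2) \<le> 1"
  shows "cmod (2 * (\<Sum>i\<in>I. cnj (x1 i) * y1 i) + 2 * (\<Sum>i\<in>I. cnj (x1 i) * y2 i)
             + 2 * (\<Sum>i\<in>I. cnj (x2 i) * y1 i) - (\<Sum>i\<in>I. cnj (x2 i) * y2 i)) \<le> 3 * sqrt 3"
proof -
  have eq: "2 * (\<Sum>i\<in>I. cnj (x1 i) * y1 i) + 2 * (\<Sum>i\<in>I. cnj (x1 i) * y2 i)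
             + 2 * (\<Sum>i\<in>I. cnj (x2 i) * y1 i) - (\<Sum>i\<in>I. cnj (x2 i) * y2 i)
      = (\<Sum>i\<in>I. cnj (x1 i) * (2 * y1 i + 2 * y2 i) + cnj (x2 i) * (2 * y1 i - y2 i))"
    unfolding sum_distrib_left sum.distrib[symmetric] sum_subtractf[symmetric]
    by (intro sum.cong) (simp_all add: algebra_simps)
  have "cmod (\<Sum>i\<in>I. cnj (x1 i) * (2 * y1 i + 2 * y2 i) + cnj (x2 i) * (2 * y1 i - y2 i))
      \<le> (\<Sum>i\<in>I. sqrt 3 * (cmod (x1 i))\<^sup>2 + sqrt 3 / 2 * (cmod (x2 i))\<^sup>2
      + sqrt 3 * (cmod (y1 i))\<^sup>2 + sqrt 3 / 2 * (cmod (y2 i))\<^sup>2)"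
    by (rule order_trans[OF norm_sum]) (intro sum_mono three_ones_pointwise)
  also have "\<dots> = sqrt 3 * (\<Sum>i\<in>I. (cmod (x1 i))\<^sup>2) + sqrt 3 / 2 * (\<Sum>i\<in>I. (cmod (x2 i))\<^sup>2)
      + sqrt 3 * (\<Sum>i\<in>I. (cmod (y1 i))\<^sup>2) + sqrt 3 / 2 * (\<Sum>i\<in>I. (cmod (y2 i))\<^sup>2)"
    by (simp only: sum.distrib sum_distrib_left)
  also have "\<dots> \<le> sqrt 3 * 1 + sqrt 3 / 2 * 1 + sqrt 3 * 1 + sqrt 3 / 2 * 1"
    using assms by (intro add_mono mult_left_mono) auto
  also have "\<dots> = 3 * sqrt 3" by linarith
  finally show ?thesis unfolding eq .
qed

context finite_group
begin

text \<open>The left-hand side is the inner product of two columns of the tensor product representation of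
  \<open>G \<times> G\<close>, whose coordinates are indexed by pairs.\<close>

lemma tensor_coefficient:
  assumes \<pi>: "unitary_rep G \<pi>" "k < rep_degree G \<pi>" and \<sigma>: "unitary_rep G \<sigma>" "l < rep_degree G \<sigma>"
    and "a \<in> carrier G" "b \<in> carrier G" "a' \<in> carrier G" "b' \<in> carrier G"
  shows "(\<Sum>i\<in>{..<rep_degree G \<pi>} \<times> {..<rep_degree G \<sigma>}.
      cnj (\<pi> a $$ (fst i, k) * \<sigma> a' $$ (snd i, l)) * (\<pi> b $$ (fst i, k) * \<sigma> b' $$ (snd i, l)))
    = \<pi> (inv a \<otimes> b) $$ (k, k) * \<sigma> (inv a' \<otimes> b') $$ (l, l)"
proof -
  have "(\<Sum>i\<in>{..<rep_degree G \<pi>} \<times> {..<rep_degree G \<sigma>}.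
      cnj (\<pi> a $$ (fst i, k) * \<sigma> a' $$ (snd i, l)) * (\<pi> b $$ (fst i, k) * \<sigma> b' $$ (snd i, l)))
    = (\<Sum>m<rep_degree G \<pi>. \<Sum>n<rep_degree G \<sigma>.
      (cnj (\<pi> a $$ (m, k)) * \<pi> b $$ (m, k)) * (cnj (\<sigma> a' $$ (n, l)) * \<sigma> b' $$ (n, l)))"
    unfolding sum.cartesian_product by (intro sum.cong) (auto simp: mult_ac)
  also have "\<dots> = \<pi> (inv a \<otimes> b) $$ (k, k) * \<sigma> (inv a' \<otimes> b') $$ (l, l)"
    using assms by (simp add: rep_entry_inv_mult sum_product)
  finally show ?thesis .
qed

text \<open>The function \<open>(g, g') \<mapsto> f g * h g'\<close> on \<open>G \<times> G\<close> is sampled at the points \<open>s\<^sub>i\<^sup>-\<^sup>1 t\<^sub>j\<close>, and the four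
  values are combined with the weights \<open>[[2, 2], [2, -1]]\<close>.\<close>

definition three_ones_form ::
    "'g \<times> 'g \<Rightarrow> 'g \<times> 'g \<Rightarrow> 'g \<times> 'g \<Rightarrow> 'g \<times> 'g \<Rightarrow> ('g \<Rightarrow> complex) \<Rightarrow> ('g \<Rightarrow> complex) \<Rightarrow> complex" where
  "three_ones_form s1 s2 t1 t2 f h =
     2 * (f (inv (fst s1) \<otimes> fst t1) * h (inv (snd s1) \<otimes> snd t1))
   + 2 * (f (inv (fst s1) \<otimes> fst t2) * h (inv (snd s1) \<otimes> snd t2))
   + 2 * (f (inv (fst s2) \<otimes> fst t1) * h (inv (snd s2) \<otimes> snd t1))
   - f (inv (fst s2) \<otimes> fst t2) * h (inv (snd s2) \<otimes> snd t2)"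

lemma three_ones_form_sum:
  "three_ones_form s1 s2 t1 t2 (\<lambda>g. \<Sum>i\<in>I. \<alpha> i * p i g) (\<lambda>g. \<Sum>j\<in>J. \<beta> j * q j g)
   = (\<Sum>i\<in>I. \<Sum>j\<in>J. \<alpha> i * \<beta> j * three_ones_form s1 s2 t1 t2 (p i) (q j))"
  unfolding three_ones_form_def sum_product
  unfolding sum_distrib_left sum.distrib[symmetric] sum_subtractf[symmetric]
  by (intro sum.cong refl) (simp add: algebra_simps)

lemma three_ones_form_rep:
  assumes \<pi>: "unitary_rep G \<pi>" and \<sigma>: "unitary_rep G \<sigma>"
    and st: "s1 \<in> carrier G \<times> carrier G" "s2 \<in> carrier G \<times> carrier G"
      "t1 \<in> carrier G \<times> carrier G" "t2 \<in> carrier G \<times> carrier G"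
  shows "cmod (three_ones_form s1 s2 t1 t2 (rep_character \<pi>) (rep_character \<sigma>))
    \<le> 3 * sqrt 3 * (real (rep_degree G \<pi>) * real (rep_degree G \<sigma>))"
proof -
  define d e where "d = rep_degree G \<pi>" and "e = rep_degree G \<sigma>"
  have bound: "cmod (three_ones_form s1 s2 t1 t2 (\<lambda>g. \<pi> g $$ (k, k)) (\<lambda>g. \<sigma> g $$ (l, l))) \<le> 3 * sqrt 3"
    if k: "k < d" and l: "l < e" for k l
  proof -
    define X where "X s i = \<pi> (fst s) $$ (fst i, k) * \<sigma> (snd s) $$ (snd i, l)" for s i
    have coeff: "(\<Sum>i\<in>{..<d} \<times> {..<e}. cnj (X s i) * X t i)
        = \<pi> (inv (fst s) \<otimes> fst t) $$ (k, k) * \<sigma> (inv (snd s) \<otimes> snd t) $$ (l, l)"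
      if "s \<in> carrier G \<times> carrier G" "t \<in> carrier G \<times> carrier G" for s t
      unfolding X_def d_def e_def
      by (rule tensor_coefficient) (use that k l \<pi> \<sigma> in \<open>auto simp: d_def e_def\<close>)
    have unit: "(\<Sum>i\<in>{..<d} \<times> {..<e}. (cmod (X s i))\<^sup>2) \<le> 1" if s: "s \<in> carrier G \<times> carrier G" for s
    proof -
      have "complex_of_real (\<Sum>i\<in>{..<d} \<times> {..<e}. (cmod (X s i))\<^sup>2)
          = (\<Sum>i\<in>{..<d} \<times> {..<e}. cnj (X s i) * X s i)"
        unfolding of_real_sum complex_norm_square by (simp only: mult.commute)
      also have "\<dots> = 1"
        unfolding coeff[OF s s] using s k l \<pi> \<sigma> by (auto simp: rep_entry_one d_def e_def)
      finally show ?thesis by (simp only: of_real_eq_1_iff)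
    qed
    show ?thesis
      unfolding three_ones_form_def using three_ones_inequality[OF unit unit unit unit, OF st]
      by (simp only: coeff[OF st(1,3)] coeff[OF st(1,4)] coeff[OF st(2,3)] coeff[OF st(2,4)])
  qed
  have "three_ones_form s1 s2 t1 t2 (rep_character \<pi>) (rep_character \<sigma>)
      = (\<Sum>k<d. \<Sum>l<e. three_ones_form s1 s2 t1 t2 (\<lambda>g. \<pi> g $$ (k, k)) (\<lambda>g. \<sigma> g $$ (l, l)))"
    using three_ones_form_sum[of s1 s2 t1 t2 "\<lambda>_. 1" "\<lambda>k g. \<pi> g $$ (k, k)" "{..<d}" "\<lambda>_. 1" "\<lambda>l g. \<sigma> g $$ (l, l)" "{..<e}"]
    by (simp add: rep_character_def[abs_def] d_def e_def)
  also have "cmod \<dots> \<le> (\<Sum>k<d. \<Sum>l<e. 3 * sqrt 3)"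
    by (intro order_trans[OF norm_sum] sum_mono) (use bound in auto)
  finally show ?thesis by (simp add: d_def e_def mult_ac)
qed

lemma three_ones_form_bound:
  assumes f: "f \<in> class_functions G" and h: "h \<in> class_functions G"
    and st: "s1 \<in> carrier G \<times> carrier G" "s2 \<in> carrier G \<times> carrier G"
      "t1 \<in> carrier G \<times> carrier G" "t2 \<in> carrier G \<times> carrier G"
  shows "cmod (three_ones_form s1 s2 t1 t2 f h) \<le> 3 * sqrt 3 * fourier_norm G f * fourier_norm G h"
proof -
  let ?D = "unitary_dual G"
  let ?T = "three_ones_form s1 s2 t1 t2"
  have char: "?T (character_of G \<pi>) (character_of G \<sigma>)
      = ?T (rep_character (dual_rep \<pi>)) (rep_character (dual_rep \<sigma>))" for \<pi> \<sigma>
    using st by (auto simp: three_ones_form_def character_of_eq)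
  have "?T f h = (\<Sum>\<pi>\<in>?D. \<Sum>\<sigma>\<in>?D. fourier_coeff f \<pi> * fourier_coeff h \<sigma> * ?T (character_of G \<pi>) (character_of G \<sigma>))"
    by (subst fourier_expansion[OF f], subst fourier_expansion[OF h]) (rule three_ones_form_sum)
  also have "cmod \<dots> \<le> (\<Sum>\<pi>\<in>?D. \<Sum>\<sigma>\<in>?D. cmod (fourier_coeff f \<pi>) * cmod (fourier_coeff h \<sigma>) *
      (3 * sqrt 3 * (real (degree_of G \<pi>) * real (degree_of G \<sigma>))))"
    unfolding norm_mult[symmetric] degree_of_eq
    by (intro order_trans[OF norm_sum] sum_mono, unfold norm_mult char, intro mult_left_mono
        three_ones_form_rep dual_rep_unitary st mult_nonneg_nonneg norm_ge_zero)
  also have "\<dots> = 3 * sqrt 3 * (fourier_norm G f * fourier_norm G h)"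
    unfolding fourier_norm_eq[OF f] fourier_norm_eq[OF h] sum_product
    unfolding sum_distrib_left by (intro sum.cong refl) (simp only: mult_ac)
  finally have "cmod (?T f h) \<le> 3 * sqrt 3 * (fourier_norm G f * fourier_norm G h)" .
  then show ?thesis by (simp only: mult.assoc)
qed

end

section \<open>Functionals on the projective tensor square\<close>

lemma proj_tensor_functional_bound:
  assumes u: "u \<in> proj_tensor A" and \<phi>: "\<phi> \<in> bounded_bilinear_forms A"
    and K: "K > 0" "\<And>x y. x \<in> carrier A \<Longrightarrow> y \<in> carrier A \<Longrightarrow> cmod (\<phi> x y) \<le> K * nrm A x * nrm A y"
  shows "cmod (u \<phi>) \<le> K * proj_norm A u"
proof -
  have "cmod (u \<phi>) / K \<le> proj_norm A u"
    unfolding proj_norm_def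
  proof (rule cInf_greatest)
    show "{(\<Sum>n. nrm A (a n) * nrm A (b n)) | a b. represents A a b u} \<noteq> {}"
      using u unfolding proj_tensor_def by blast
  next
    fix r assume "r \<in> {(\<Sum>n. nrm A (a n) * nrm A (b n)) | a b. represents A a b u}"
    then obtain a b where r: "r = (\<Sum>n. nrm A (a n) * nrm A (b n))" and ab: "represents A a b u"
      by blast
    have mem: "a n \<in> carrier A" "b n \<in> carrier A" for n using ab by (auto simp: represents_def)
    have sm: "summable (\<lambda>n. nrm A (a n) * nrm A (b n))" using ab by (simp add: represents_def)
    have "u \<phi> = (\<Sum>n. \<phi> (a n) (b n))" using ab \<phi> by (simp add: represents_def)
    moreover have "norm (\<Sum>n. \<phi> (a n) (b n)) \<le> (\<Sum>n. K * (nrm A (a n) * nrm A (b n)))"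
      by (rule norm_suminf_le) (use K(2)[OF mem] sm in \<open>simp_all add: mult.assoc summable_mult\<close>)
    moreover have "(\<Sum>n. K * (nrm A (a n) * nrm A (b n))) = K * r"
      unfolding r by (rule suminf_mult[OF sm])
    ultimately show "cmod (u \<phi>) / K \<le> r" using K(1) by (simp add: pos_divide_le_eq mult.commute)
  qed
  then show ?thesis using K(1) by (simp add: pos_divide_le_eq mult.commute)
qed

text \<open>Used to write the difference of two tensors as a single series.\<close>

lemma sums_interleave:
  fixes f g :: "nat \<Rightarrow> complex"
  assumes "f sums x" "g sums y"
  shows "(\<lambda>n. if even n then f (n div 2) else g (n div 2)) sums (x + y)"
proof -
  have *: "(\<lambda>n. if even n then p (n div 2) else q (n div 2)) sums (a + b)"
    if "p sums a" "q sums b" for p q :: "nat \<Rightarrow> real" and a b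
  proof -
    have "(\<lambda>n. if even n then p (n div 2) else q ((n - 1) div 2)) sums (b + a)"
      by (rule sums_if[OF that(2,1)])
    moreover have "(\<lambda>n. if even n then p (n div 2) else q ((n - 1) div 2))
        = (\<lambda>n. if even n then p (n div 2) else q (n div 2))"
    proof
      fix n show "(if even n then p (n div 2) else q ((n - 1) div 2))
          = (if even n then p (n div 2) else q (n div 2))"
        by (cases "even n") (auto elim: oddE)
    qed
    ultimately show ?thesis by (simp add: add.commute)
  qed
  from assms have "(\<lambda>n. Re (f n)) sums Re x" "(\<lambda>n. Im (f n)) sums Im x"
    "(\<lambda>n. Re (g n)) sums Re y" "(\<lambda>n. Im (g n)) sums Im y"
    by (simp_all add: sums_complex_iff)
  from *[OF this(1,3)] *[OF this(2,4)] show ?thesis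
    by (simp add: sums_complex_iff if_distrib cong: if_cong)
qed

lemma summable_interleave:
  fixes f g :: "nat \<Rightarrow> real"
  assumes "summable f" "summable g"
  shows "summable (\<lambda>n. if even n then f (n div 2) else g (n div 2))"
proof -
  have "(\<lambda>n. complex_of_real (f n)) sums of_real (suminf f)" "(\<lambda>n. complex_of_real (g n)) sums of_real (suminf g)"
    using assms by (simp_all add: sums_of_real summable_sums)
  from sums_interleave[OF this] have "(\<lambda>n. if even n then f (n div 2) else g (n div 2)) sums (suminf f
      + suminf g)"
    by (simp add: sums_complex_iff if_distrib cong: if_cong)
  then show ?thesis by (rule sums_summable)
qed

lemma tendsto_zero_comparison:
  assumes "eventually (\<lambda>x. norm (f x) \<le> g x) F" "(g \<longlongrightarrow> 0) F"
  shows "(f \<longlongrightarrow> 0) F"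
proof (rule tendsto_0_le[OF assms(2), where K = 1])
  show "eventually (\<lambda>x. norm (f x) \<le> norm (g x) * 1) F"
    using assms(1) by (rule eventually_mono) simp
qed

section \<open>The algebra of class functions\<close>

lemma ZA_simps:
  "carrier (ZA G) = class_functions G"
  "f \<otimes>\<^bsub>ZA G\<^esub> h = (\<lambda>x. f x * h x)"
  "f \<oplus>\<^bsub>ZA G\<^esub> h = (\<lambda>x. f x + h x)"
  "\<zero>\<^bsub>ZA G\<^esub> = (\<lambda>x. 0)"
  "c \<odot>\<^bsub>ZA G\<^esub> f = (\<lambda>x. c * f x)"
  "nrm (ZA G) = fourier_norm G"
  by (simp_all add: ZA_def)

context finite_group
begin

lemma class_functions_mult:
  "f \<in> class_functions G \<Longrightarrow> h \<in> class_functions G \<Longrightarrow> (\<lambda>x. f x * h x) \<in> class_functions G"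
  by (simp add: class_functions_def)

lemma class_functions_diff:
  "f \<in> class_functions G \<Longrightarrow> h \<in> class_functions G \<Longrightarrow> (\<lambda>x. f x - h x) \<in> class_functions G"
  by (simp add: class_functions_def)

lemma class_functions_uminus:
  "f \<in> class_functions G \<Longrightarrow> (\<lambda>x. - f x) \<in> class_functions G"
  by (simp add: class_functions_def)

lemma class_functions_zero: "(\<lambda>x. 0) \<in> class_functions G"
  by (simp add: class_functions_def)

lemma class_functions_add:
  "f \<in> class_functions G \<Longrightarrow> h \<in> class_functions G \<Longrightarrow> (\<lambda>x. f x + h x) \<in> class_functions G"
  by (simp add: class_functions_def)

lemma abelian_group_ZA: "abelian_group (ZA G)"
proof (rule abelian_groupI)
  fix f assume f: "f \<in> carrier (ZA G)"
  show "\<exists>h\<in>carrier (ZA G). h \<oplus>\<^bsub>ZA G\<^esub> f = \<zero>\<^bsub>ZA G\<^esub>"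
    by (rule bexI[of _ "\<lambda>x. - f x"]) (use f class_functions_uminus in \<open>simp_all add: ZA_simps\<close>)
qed (simp_all add: ZA_simps class_functions_add class_functions_zero ac_simps)

lemma ZA_minus:
  assumes "f \<in> class_functions G" "h \<in> class_functions G"
  shows "f \<ominus>\<^bsub>ZA G\<^esub> h = (\<lambda>x. f x - h x)"
proof -
  interpret Z: abelian_group "ZA G" by (rule abelian_group_ZA)
  have "\<ominus>\<^bsub>ZA G\<^esub> h = (\<lambda>x. - h x)"
    by (rule Z.minus_equality) (use assms class_functions_uminus in \<open>simp_all add: ZA_simps\<close>)
  then show ?thesis by (simp add: a_minus_def ZA_simps)
qed

lemma ZA_finsum:
  assumes "\<And>n. f n \<in> class_functions G"
  shows "(\<Oplus>\<^bsub>ZA G\<^esub>n\<in>{..<N::nat}. f n) = (\<lambda>x. \<Sum>n<N. f n x)"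
proof -
  interpret Z: abelian_group "ZA G" by (rule abelian_group_ZA)
  show ?thesis
  proof (induction N)
    case 0
    then show ?case by (simp add: ZA_simps)
  next
    case (Suc N)
    have "(\<Oplus>\<^bsub>ZA G\<^esub>n\<in>{..<Suc N}. f n) = f N \<oplus>\<^bsub>ZA G\<^esub> (\<Oplus>\<^bsub>ZA G\<^esub>n\<in>{..<N}. f n)"
      unfolding lessThan_Suc by (rule Z.finsum_insert) (use assms in \<open>auto simp: ZA_simps\<close>)
    then show ?case unfolding Suc.IH by (simp add: ZA_simps add.commute)
  qed
qed

lemma fourier_norm_mult_bound:
  assumes c: "c \<in> class_functions G"
  obtains K where "\<And>f. f \<in> class_functions G \<Longrightarrow>
    fourier_norm G (\<lambda>x. c x * f x) \<le> K * fourier_norm G f"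
proof -
  obtain K where K: "\<And>f B. f \<in> class_functions G \<Longrightarrow> (\<And>g. g \<in> carrier G \<Longrightarrow> cmod (f g) \<le> B) \<Longrightarrow>
      fourier_norm G f \<le> K * B"
    by (rule fourier_norm_bounded_by_sup) blast
  define C where "C = (\<Sum>g\<in>carrier G. cmod (c g))"
  show ?thesis
  proof (rule that[of "K * C"])
    fix f assume f: "f \<in> class_functions G"
    have "cmod (c g * f g) \<le> C * fourier_norm G f" if g: "g \<in> carrier G" for g
    proof -
      have "cmod (c g) \<le> C" unfolding C_def using g finite_carrier by (intro member_le_sum) auto
      then show ?thesis using cmod_le_fourier_norm[OF f g] fourier_norm_nonneg[OF f]
        by (simp add: norm_mult mult_mono')
    qed
    from K[OF class_functions_mult[OF c f] this]
    show "fourier_norm G (\<lambda>x. c x * f x) \<le> K * C * fourier_norm G f" by (simp add: mult.assoc)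
  qed
qed

lemma bounded_bilinear_forms_ZA_I:
  assumes "\<And>x y z. x \<in> class_functions G \<Longrightarrow> y \<in> class_functions G \<Longrightarrow> z \<in> class_functions G \<Longrightarrow>
      \<phi> (\<lambda>g. x g + y g) z = \<phi> x z + \<phi> y z"
    "\<And>x y z. x \<in> class_functions G \<Longrightarrow> y \<in> class_functions G \<Longrightarrow> z \<in> class_functions G \<Longrightarrow>
      \<phi> z (\<lambda>g. x g + y g) = \<phi> z x + \<phi> z y"
    "\<And>c x y. x \<in> class_functions G \<Longrightarrow> y \<in> class_functions G \<Longrightarrow> \<phi> (\<lambda>g. c * x g) y = c * \<phi> x y"
    "\<And>c x y. x \<in> class_functions G \<Longrightarrow> y \<in> class_functions G \<Longrightarrow> \<phi> x (\<lambda>g. c * y g) = c * \<phi> x y"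
    "\<And>x y. x \<in> class_functions G \<Longrightarrow> y \<in> class_functions G \<Longrightarrow> cmod (\<phi> x y)
        \<le> B * fourier_norm G x * fourier_norm G y"
  shows "\<phi> \<in> bounded_bilinear_forms (ZA G)"
  unfolding bounded_bilinear_forms_def ZA_simps
  by (intro CollectI conjI ballI allI exI[of _ B] assms)

lemma bounded_bilinear_forms_ZA_D:
  assumes "\<phi> \<in> bounded_bilinear_forms (ZA G)"
  shows "x \<in> class_functions G \<Longrightarrow> y \<in> class_functions G \<Longrightarrow> z \<in> class_functions G \<Longrightarrow>
      \<phi> (\<lambda>g. x g + y g) z = \<phi> x z + \<phi> y z"
    "x \<in> class_functions G \<Longrightarrow> y \<in> class_functions G \<Longrightarrow> z \<in> class_functions G \<Longrightarrow>
      \<phi> z (\<lambda>g. x g + y g) = \<phi> z x + \<phi> z y"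
    "x \<in> class_functions G \<Longrightarrow> y \<in> class_functions G \<Longrightarrow> \<phi> (\<lambda>g. c * x g) y = c * \<phi> x y"
    "x \<in> class_functions G \<Longrightarrow> y \<in> class_functions G \<Longrightarrow> \<phi> x (\<lambda>g. c * y g) = c * \<phi> x y"
    "\<exists>B\<ge>0. \<forall>x\<in>class_functions G. \<forall>y\<in>class_functions G. cmod (\<phi> x y)
        \<le> B * fourier_norm G x * fourier_norm G y"
proof -
  note D = assms[unfolded bounded_bilinear_forms_def ZA_simps mem_Collect_eq]
  show "x \<in> class_functions G \<Longrightarrow> y \<in> class_functions G \<Longrightarrow> z \<in> class_functions G \<Longrightarrow>
      \<phi> (\<lambda>g. x g + y g) z = \<phi> x z + \<phi> y z"
    by (rule conjunct1[OF conjunct1[OF D, rule_format]])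
  show "x \<in> class_functions G \<Longrightarrow> y \<in> class_functions G \<Longrightarrow> z \<in> class_functions G \<Longrightarrow>
      \<phi> z (\<lambda>g. x g + y g) = \<phi> z x + \<phi> z y"
    by (rule conjunct2[OF conjunct1[OF D, rule_format]])
  show "x \<in> class_functions G \<Longrightarrow> y \<in> class_functions G \<Longrightarrow> \<phi> (\<lambda>g. c * x g) y = c * \<phi> x y"
    by (rule conjunct1[OF conjunct1[OF conjunct2[OF D], rule_format]])
  show "x \<in> class_functions G \<Longrightarrow> y \<in> class_functions G \<Longrightarrow> \<phi> x (\<lambda>g. c * y g) = c * \<phi> x y"
    by (rule conjunct2[OF conjunct1[OF conjunct2[OF D], rule_format]])
  obtain B where B: "\<forall>x\<in>class_functions G. \<forall>y\<in>class_functions G. cmod (\<phi> x y)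
      \<le> B * fourier_norm G x * fourier_norm G y"
    using conjunct2[OF conjunct2[OF D]] by (rule exE)
  have "cmod (\<phi> x y) \<le> \<bar>B\<bar> * fourier_norm G x * fourier_norm G y" if xy: "x \<in> class_functions G" "y \<in> class_functions G" for x y
  proof -
    have "cmod (\<phi> x y) \<le> B * fourier_norm G x * fourier_norm G y" using B xy by blast
    also have "\<dots> \<le> \<bar>B\<bar> * fourier_norm G x * fourier_norm G y"
      using fourier_norm_nonneg xy by (intro mult_right_mono) auto
    finally show ?thesis .
  qed
  then show "\<exists>B\<ge>0. \<forall>x\<in>class_functions G. \<forall>y\<in>class_functions G. cmod (\<phi> x y)
      \<le> B * fourier_norm G x * fourier_norm G y"
    by (intro exI[of _ "\<bar>B\<bar>"]) simp
qed

lemma bounded_bilinear_forms_mult_left: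
  assumes \<phi>: "\<phi> \<in> bounded_bilinear_forms (ZA G)" and c: "c \<in> class_functions G"
  shows "(\<lambda>x y. \<phi> (\<lambda>g. c g * x g) y) \<in> bounded_bilinear_forms (ZA G)"
proof -
  note D = bounded_bilinear_forms_ZA_D[OF \<phi>]
  note cm = class_functions_mult[OF c]
  obtain B where B: "B \<ge> 0" "\<And>x y. x \<in> class_functions G \<Longrightarrow> y \<in> class_functions G \<Longrightarrow> cmod (\<phi> x y)
      \<le> B * fourier_norm G x * fourier_norm G y"
    using D(5) by blast
  obtain K where K: "\<And>f. f \<in> class_functions G \<Longrightarrow> fourier_norm G (\<lambda>x. c x * f x) \<le> K * fourier_norm G f"
    by (rule fourier_norm_mult_bound[OF c]) blast
  show ?thesis
  proof (rule bounded_bilinear_forms_ZA_I)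
    fix x y assume xy: "x \<in> class_functions G" "y \<in> class_functions G"
    have "cmod (\<phi> (\<lambda>g. c g * x g) y) \<le> B * fourier_norm G (\<lambda>g. c g * x g) * fourier_norm G y"
      by (rule B(2)[OF cm[OF xy(1)] xy(2)])
    also have "\<dots> \<le> B * (K * fourier_norm G x) * fourier_norm G y"
      using B(1) K[OF xy(1)] fourier_norm_nonneg[OF xy(2)] by (intro mult_right_mono mult_left_mono)
    finally show "cmod (\<phi> (\<lambda>g. c g * x g) y) \<le> (B * K) * fourier_norm G x * fourier_norm G y"
      by (simp only: mult.assoc)
  qed (simp_all add: distrib_left mult.left_commute[of "c _"] D(1-4) cm)
qed

lemma bounded_bilinear_forms_swap:
  assumes \<phi>: "\<phi> \<in> bounded_bilinear_forms (ZA G)"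
  shows "(\<lambda>x y. \<phi> y x) \<in> bounded_bilinear_forms (ZA G)"
proof -
  note D = bounded_bilinear_forms_ZA_D[OF \<phi>]
  obtain B where B: "\<And>x y. x \<in> class_functions G \<Longrightarrow> y \<in> class_functions G \<Longrightarrow> cmod (\<phi> x y)
      \<le> B * fourier_norm G x * fourier_norm G y"
    using D(5) by blast
  show ?thesis
  proof (rule bounded_bilinear_forms_ZA_I)
    fix x y assume xy: "x \<in> class_functions G" "y \<in> class_functions G"
    show "cmod (\<phi> y x) \<le> B * fourier_norm G x * fourier_norm G y"
      using B[OF xy(2,1)] by (simp only: mult_ac)
  qed (simp_all add: D(1-4))
qed

lemma bounded_bilinear_forms_mult_right:
  assumes \<phi>: "\<phi> \<in> bounded_bilinear_forms (ZA G)" and c: "c \<in> class_functions G"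
  shows "(\<lambda>x y. \<phi> x (\<lambda>g. y g * c g)) \<in> bounded_bilinear_forms (ZA G)"
  using bounded_bilinear_forms_swap[OF bounded_bilinear_forms_mult_left[OF bounded_bilinear_forms_swap[OF \<phi>] c]]
  by (simp only: mult.commute)

definition point_form :: "'g \<Rightarrow> 'g \<Rightarrow> ('g \<Rightarrow> complex) \<Rightarrow> ('g \<Rightarrow> complex) \<Rightarrow> complex" where
  "point_form g h x y = x g * y h"

lemma point_form_bound:
  assumes "g \<in> carrier G" "h \<in> carrier G" "x \<in> class_functions G" "y \<in> class_functions G"
  shows "cmod (point_form g h x y) \<le> 1 * fourier_norm G x * fourier_norm G y"
  using assms by (simp add: point_form_def norm_mult mult_mono' cmod_le_fourier_norm)

lemma point_form_bilinear:
  assumes "g \<in> carrier G" "h \<in> carrier G"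
  shows "point_form g h \<in> bounded_bilinear_forms (ZA G)"
  by (rule bounded_bilinear_forms_ZA_I[where B = 1])
     (use point_form_bound[OF assms] in \<open>simp_all add: point_form_def algebra_simps\<close>)

lemma three_ones_form_bilinear:
  assumes "s1 \<in> carrier G \<times> carrier G" "s2 \<in> carrier G \<times> carrier G"
      "t1 \<in> carrier G \<times> carrier G" "t2 \<in> carrier G \<times> carrier G"
  shows "three_ones_form s1 s2 t1 t2 \<in> bounded_bilinear_forms (ZA G)"
proof (rule bounded_bilinear_forms_ZA_I[where B = "3 * sqrt 3"])
  fix x y assume "x \<in> class_functions G" "y \<in> class_functions G"
  then show "cmod (three_ones_form s1 s2 t1 t2 x y) \<le> 3 * sqrt 3 * fourier_norm G x * fourier_norm G y"
    using assms by (rule three_ones_form_bound)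
qed (simp_all add: three_ones_form_def algebra_simps)

section \<open>Tensors over the algebra of class functions\<close>

lemma represents_ZA_mem:
  assumes "represents (ZA G) a b u"
  shows "a n \<in> class_functions G" "b n \<in> class_functions G"
  using assms by (auto simp: represents_def ZA_simps)

lemma represents_ZA_summable:
  assumes "represents (ZA G) a b u"
  shows "summable (\<lambda>n. fourier_norm G (a n) * fourier_norm G (b n))"
  using assms by (simp add: represents_def ZA_simps)

text \<open>The defining series of a tensor converges for every bounded form, so that \<open>suminf\<close> takes no default
  value.\<close>

lemma represents_ZA_sums:
  assumes ab: "represents (ZA G) a b u" and \<phi>: "\<phi> \<in> bounded_bilinear_forms (ZA G)"
  shows "(\<lambda>n. \<phi> (a n) (b n)) sums u \<phi>"
proof -
  note mem = represents_ZA_mem[OF ab]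
  obtain B where B: "\<And>x y. x \<in> class_functions G \<Longrightarrow> y \<in> class_functions G \<Longrightarrow> cmod (\<phi> x y)
      \<le> B * fourier_norm G x * fourier_norm G y"
    using bounded_bilinear_forms_ZA_D(5)[OF \<phi>] by blast
  have "summable (\<lambda>n. \<phi> (a n) (b n))"
  proof (rule summable_comparison_test')
    show "summable (\<lambda>n. B * (fourier_norm G (a n) * fourier_norm G (b n)))"
      by (rule summable_mult[OF represents_ZA_summable[OF ab]])
    fix n show "norm (\<phi> (a n) (b n)) \<le> B * (fourier_norm G (a n) * fourier_norm G (b n))"
      using B[OF mem] by (simp only: mult.assoc)
  qed
  moreover have "u \<phi> = (\<Sum>n. \<phi> (a n) (b n))" using ab \<phi> by (simp add: represents_def)
  ultimately show ?thesis by (simp add: summable_sums)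
qed

lemma tensor_point_sums:
  assumes "represents (ZA G) a b u" "g \<in> carrier G" "h \<in> carrier G"
  shows "(\<lambda>n. a n g * b n h) sums u (point_form g h)"
  using represents_ZA_sums[OF assms(1) point_form_bilinear[OF assms(2,3)]] by (simp add: point_form_def)

lemma tensor_point_conjugate:
  assumes u: "u \<in> proj_tensor (ZA G)" and g: "g \<in> carrier G" and k: "k \<in> carrier G"
  shows "u (point_form g (k \<otimes> g \<otimes> inv k)) = u (point_form g g)"
proof -
  from u obtain a b where ab: "represents (ZA G) a b u" by (auto simp: proj_tensor_def)
  have "b n (k \<otimes> g \<otimes> inv k) = b n g" for n
    using represents_ZA_mem(2)[OF ab, of n] g k by (simp add: class_functions_def)
  then have "(\<lambda>n. a n g * b n g) sums u (point_form g (k \<otimes> g \<otimes> inv k))"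
    using tensor_point_sums[OF ab g, of "k \<otimes> g \<otimes> inv k"] g k by simp
  from sums_unique2[OF this tensor_point_sums[OF ab g g]] show ?thesis .
qed

lemma tensor_three_ones:
  assumes u: "u \<in> proj_tensor (ZA G)"
    and st: "s1 \<in> carrier G \<times> carrier G" "s2 \<in> carrier G \<times> carrier G"
      "t1 \<in> carrier G \<times> carrier G" "t2 \<in> carrier G \<times> carrier G"
  shows "u (three_ones_form s1 s2 t1 t2) =
       2 * u (point_form (inv (fst s1) \<otimes> fst t1) (inv (snd s1) \<otimes> snd t1))
     + 2 * u (point_form (inv (fst s1) \<otimes> fst t2) (inv (snd s1) \<otimes> snd t2))
     + 2 * u (point_form (inv (fst s2) \<otimes> fst t1) (inv (snd s2) \<otimes> snd t1))
     - u (point_form (inv (fst s2) \<otimes> fst t2) (inv (snd s2) \<otimes> snd t2))"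
proof -
  from u obtain a b where ab: "represents (ZA G) a b u" by (auto simp: proj_tensor_def)
  have p: "(\<lambda>n. a n (inv (fst s) \<otimes> fst t) * b n (inv (snd s) \<otimes> snd t))
      sums u (point_form (inv (fst s) \<otimes> fst t) (inv (snd s) \<otimes> snd t))"
    if "s \<in> carrier G \<times> carrier G" "t \<in> carrier G \<times> carrier G" for s t
    using that by (intro tensor_point_sums[OF ab]) auto
  have "(\<lambda>n. three_ones_form s1 s2 t1 t2 (a n) (b n)) sums
     (2 * u (point_form (inv (fst s1) \<otimes> fst t1) (inv (snd s1) \<otimes> snd t1))
     + 2 * u (point_form (inv (fst s1) \<otimes> fst t2) (inv (snd s1) \<otimes> snd t2))
     + 2 * u (point_form (inv (fst s2) \<otimes> fst t1) (inv (snd s2) \<otimes> snd t1))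
     - u (point_form (inv (fst s2) \<otimes> fst t2) (inv (snd s2) \<otimes> snd t2)))"
    unfolding three_ones_form_def by (intro sums_add sums_diff sums_mult p st)
  from sums_unique2[OF represents_ZA_sums[OF ab three_ones_form_bilinear[OF st]] this] show ?thesis .
qed

text \<open>Norm convergence of the series of products is the same as pointwise convergence, and the limit at
  \<open>g\<close> is the value of the tensor at the point form \<open>(g, g)\<close>. This identifies the definite description
  and shows that it does not depend on the series.\<close>

lemma mult_map_ZA:
  assumes u: "u \<in> proj_tensor (ZA G)"
  shows "mult_map (ZA G) u = (\<lambda>g. if g \<in> carrier G then u (point_form g g) else 0)"
    and "mult_map (ZA G) u \<in> class_functions G"
proof -
  define c where "c = (\<lambda>g. if g \<in> carrier G then u (point_form g g) else 0)"
  define S where "S a b N = (\<lambda>g. \<Sum>n<N. a n g * b n g)" for a b :: "nat \<Rightarrow> 'g \<Rightarrow> complex" and N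
  have S: "S a b N \<in> class_functions G" if ab: "represents (ZA G) a b u" for a b N
    using represents_ZA_mem[OF ab] unfolding S_def class_functions_def by simp
  have fin: "(\<Oplus>\<^bsub>ZA G\<^esub>n\<in>{..<N}. a n \<otimes>\<^bsub>ZA G\<^esub> b n) = S a b N" if ab: "represents (ZA G) a b u" for a b N
    unfolding ZA_simps(2) S_def
    by (rule ZA_finsum) (intro class_functions_mult represents_ZA_mem[OF ab])
  have lim: "(\<lambda>N. S a b N g) \<longlonglongrightarrow> c g" if "represents (ZA G) a b u" "g \<in> carrier G" for a b g
    using tensor_point_sums[OF that(1,2,2)] that(2) by (simp add: sums_def S_def c_def)
  from u obtain a b where ab: "represents (ZA G) a b u" by (auto simp: proj_tensor_def)
  have c: "c \<in> class_functions G"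
    unfolding class_functions_def
  proof (intro CollectI conjI allI impI ballI)
    fix g h assume gh: "g \<in> carrier G" "h \<in> carrier G"
    have "S a b N (h \<otimes> g \<otimes> inv h) = S a b N g" for N
      using S[OF ab, of N] gh by (simp add: class_functions_def)
    then have "(\<lambda>N. S a b N g) \<longlonglongrightarrow> c (h \<otimes> g \<otimes> inv h)"
      using lim[OF ab, of "h \<otimes> g \<otimes> inv h"] gh by simp
    then show "c (h \<otimes> g \<otimes> inv h) = c g" by (rule LIMSEQ_unique[OF _ lim[OF ab gh(1)]])
  qed (simp add: c_def)
  have "mult_map (ZA G) u = c"
    unfolding mult_map_def
  proof (rule the_equality)
    obtain K where K: "\<And>f B. f \<in> class_functions G \<Longrightarrow> (\<And>g. g \<in> carrier G \<Longrightarrow> cmod (f g) \<le> B) \<Longrightarrow>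
        fourier_norm G f \<le> K * B"
      by (rule fourier_norm_bounded_by_sup) blast
    have "(\<lambda>N. fourier_norm G (\<lambda>g. c g - S a b N g)) \<longlonglongrightarrow> 0"
    proof (rule tendsto_sandwich[OF always_eventually always_eventually])
      show "\<forall>N. 0 \<le> fourier_norm G (\<lambda>g. c g - S a b N g)"
        using class_functions_diff[OF c S[OF ab]] fourier_norm_nonneg by blast
      show "\<forall>N. fourier_norm G (\<lambda>g. c g - S a b N g) \<le> K * (\<Sum>g\<in>carrier G. cmod (c g - S a b N g))"
      proof
        fix N
        show "fourier_norm G (\<lambda>g. c g - S a b N g) \<le> K * (\<Sum>g\<in>carrier G. cmod (c g - S a b N g))"
          by (rule K[OF class_functions_diff[OF c S[OF ab]]]) (rule member_le_sum, use finite_carrier in auto)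
      qed
      have "(\<lambda>N. cmod (c g - S a b N g)) \<longlonglongrightarrow> 0" if "g \<in> carrier G" for g
        using tendsto_norm[OF tendsto_diff[OF tendsto_const lim[OF ab that]], of "c g"] by simp
      from tendsto_mult_right_zero[OF tendsto_null_sum[OF this]]
      show "(\<lambda>N. K * (\<Sum>g\<in>carrier G. cmod (c g - S a b N g))) \<longlonglongrightarrow> 0" .
    qed (rule tendsto_const)
    then show "c \<in> carrier (ZA G) \<and> (\<exists>a b. represents (ZA G) a b u \<and>
        (\<lambda>N. nrm (ZA G) (c \<ominus>\<^bsub>ZA G\<^esub> (\<Oplus>\<^bsub>ZA G\<^esub>n\<in>{..<N}. a n \<otimes>\<^bsub>ZA G\<^esub> b n))) \<longlonglongrightarrow> 0)"
      using c ab by (intro conjI exI[of _ a] exI[of _ b])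
          (simp_all only: fin[OF ab] ZA_minus[OF c S[OF ab]] ZA_simps(1,6))
  next
    fix c' assume "c' \<in> carrier (ZA G) \<and> (\<exists>a b. represents (ZA G) a b u \<and>
        (\<lambda>N. nrm (ZA G) (c' \<ominus>\<^bsub>ZA G\<^esub> (\<Oplus>\<^bsub>ZA G\<^esub>n\<in>{..<N}. a n \<otimes>\<^bsub>ZA G\<^esub> b n))) \<longlonglongrightarrow> 0)"
    then obtain a b where c': "c' \<in> class_functions G" and ab: "represents (ZA G) a b u"
      and "(\<lambda>N. nrm (ZA G) (c' \<ominus>\<^bsub>ZA G\<^esub> (\<Oplus>\<^bsub>ZA G\<^esub>n\<in>{..<N}. a n \<otimes>\<^bsub>ZA G\<^esub> b n))) \<longlonglongrightarrow> 0"
      by (auto simp: ZA_simps(1))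
    then have l0: "(\<lambda>N. fourier_norm G (\<lambda>g. c' g - S a b N g)) \<longlonglongrightarrow> 0"
      by (simp only: fin[OF ab] ZA_minus[OF c' S[OF ab]] ZA_simps(6))
    show "c' = c"
    proof
      fix g
      show "c' g = c g"
      proof (cases "g \<in> carrier G")
        case True
        have "(\<lambda>N. c' g - S a b N g) \<longlonglongrightarrow> 0"
          by (rule tendsto_zero_comparison[OF always_eventually l0])
             (use cmod_le_fourier_norm[OF class_functions_diff[OF c' S[OF ab]] True] in simp)
        moreover have "(\<lambda>N. c' g - S a b N g) \<longlonglongrightarrow> c' g - c g"
          by (intro tendsto_diff tendsto_const lim[OF ab True])
        ultimately show ?thesis using LIMSEQ_unique by fastforce
      next
        case False
        then show ?thesis using c c' by (simp add: class_functions_def)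
      qed
    qed
  qed
  with c show "mult_map (ZA G) u = (\<lambda>g. if g \<in> carrier G then u (point_form g g) else 0)"
    "mult_map (ZA G) u \<in> class_functions G" by (simp_all add: c_def)
qed

text \<open>The difference of the two actions has to be a member of the projective tensor product for its
  norm to bound its values; the series of the two actions are interleaved, with the sign put on the
  first factor.\<close>

lemma act_difference:
  assumes u: "u \<in> proj_tensor (ZA G)" and c: "c \<in> class_functions G"
  defines "D \<equiv> (\<lambda>\<phi>. left_act (ZA G) c u \<phi> - right_act (ZA G) u c \<phi>)"
  shows "D \<in> proj_tensor (ZA G)"
    and "g \<in> carrier G \<Longrightarrow> h \<in> carrier G \<Longrightarrow> D (point_form g h) = (c g - c h) * u (point_form g h)"
proof -
  from u obtain a b where ab: "represents (ZA G) a b u" by (auto simp: proj_tensor_def)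
  note mem = represents_ZA_mem[OF ab]
  \<comment> \<open>Even positions carry the series of the left action, odd positions minus that of the right action.\<close>
  define a' where "a' n = (if even n then (\<lambda>g. c g * a (n div 2) g) else (\<lambda>g. - 1 * a (n div 2) g))" for n
  define b' where "b' n = (if even n then b (n div 2) else (\<lambda>g. b (n div 2) g * c g))" for n
  have neg: "(\<lambda>g. - 1 * a n g) \<in> class_functions G" for n using mem(1)[of n] by
      (simp add: class_functions_def)
  have bc: "(\<lambda>g. b n g * c g) \<in> class_functions G" for n by (rule class_functions_mult[OF mem(2) c])
  have ca: "(\<lambda>g. c g * a n g) \<in> class_functions G" for n by (rule class_functions_mult[OF c mem(1)])
  have D: "D \<phi> = (if \<phi> \<in> bounded_bilinear_forms (ZA G) then
      u (\<lambda>x y. \<phi> (\<lambda>g. c g * x g) y) - u (\<lambda>x y. \<phi> x (\<lambda>g. y g * c g)) else 0)" for \<phi>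
    by (simp add: D_def left_act_def right_act_def ZA_simps)
  have sums: "(\<lambda>n. \<phi> (a' n) (b' n)) sums D \<phi>" if \<phi>: "\<phi> \<in> bounded_bilinear_forms (ZA G)" for \<phi>
  proof -
    have l: "(\<lambda>n. \<phi> (\<lambda>g. c g * a n g) (b n)) sums u (\<lambda>x y. \<phi> (\<lambda>g. c g * x g) y)"
      by (rule represents_ZA_sums[OF ab bounded_bilinear_forms_mult_left[OF \<phi> c]])
    have r: "(\<lambda>n. \<phi> (a n) (\<lambda>g. b n g * c g)) sums u (\<lambda>x y. \<phi> x (\<lambda>g. y g * c g))"
      by (rule represents_ZA_sums[OF ab bounded_bilinear_forms_mult_right[OF \<phi> c]])
    have "(\<lambda>n. if even n then \<phi> (\<lambda>g. c g * a (n div 2) g) (b (n div 2))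
        else - 1 * \<phi> (a (n div 2)) (\<lambda>g. b (n div 2) g * c g)) sums
        (u (\<lambda>x y. \<phi> (\<lambda>g. c g * x g) y) + - 1 * u (\<lambda>x y. \<phi> x (\<lambda>g. y g * c g)))"
      by (rule sums_interleave[OF l sums_mult[OF r]])
    moreover have "\<phi> (\<lambda>g. - 1 * a n g) (\<lambda>g. b n g * c g) = - 1 * \<phi> (a n) (\<lambda>g. b n g * c g)" for n
      by (rule bounded_bilinear_forms_ZA_D(3)[OF \<phi> mem(1) bc])
    then have "(\<lambda>n. \<phi> (a' n) (b' n)) = (\<lambda>n. if even n then \<phi> (\<lambda>g. c g * a (n div 2) g) (b (n div 2))
        else - 1 * \<phi> (a (n div 2)) (\<lambda>g. b (n div 2) g * c g))"
      unfolding a'_def b'_def by (intro ext) simp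
    moreover have "D \<phi> = u (\<lambda>x y. \<phi> (\<lambda>g. c g * x g) y) + - 1 * u (\<lambda>x y. \<phi> x (\<lambda>g. y g * c g))"
      using \<phi> by (simp add: D)
    ultimately show ?thesis by (simp only:)
  qed
  have "represents (ZA G) a' b' D"
    unfolding represents_def ZA_simps
  proof (intro conjI)
    show "range a' \<subseteq> class_functions G" using ca neg by (auto simp: a'_def)
    show "range b' \<subseteq> class_functions G" using mem(2) bc by (auto simp: b'_def)
    show "D = (\<lambda>\<phi>. if \<phi> \<in> bounded_bilinear_forms (ZA G) then \<Sum>n. \<phi> (a' n) (b' n) else 0)"
      using sums_unique[OF sums] by (intro ext) (simp add: D)
    obtain K where K: "\<And>f. f \<in> class_functions G \<Longrightarrow> fourier_norm G (\<lambda>x. c x * f x) \<le> K * fourier_norm G f"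
      by (rule fourier_norm_mult_bound[OF c]) blast
    let ?N = "\<lambda>n. fourier_norm G (a n) * fourier_norm G (b n)"
    have "summable (\<lambda>n. if even n then K * ?N (n div 2) else K * ?N (n div 2))"
      by (intro summable_interleave[of "\<lambda>n. K * ?N n" "\<lambda>n. K * ?N n"]
          summable_mult represents_ZA_summable[OF ab])
    moreover have "norm (fourier_norm G (a' n) * fourier_norm G (b' n))
        \<le> (if even n then K * ?N (n div 2) else K * ?N (n div 2))" for n
    proof (cases "even n")
      case True
      have "fourier_norm G (\<lambda>g. c g * a (n div 2) g) * fourier_norm G (b (n div 2))
          \<le> (K * fourier_norm G (a (n div 2))) * fourier_norm G (b (n div 2))"
        by (intro mult_right_mono K mem fourier_norm_nonneg)
      then show ?thesis using True fourier_norm_nonneg[OF ca] fourier_norm_nonneg[OF mem(2)]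
        by (simp add: a'_def b'_def mult.assoc)
    next
      case False
      have "fourier_norm G (\<lambda>g. - 1 * a (n div 2) g) * fourier_norm G (\<lambda>g. c g * b (n div 2) g)
          \<le> fourier_norm G (a (n div 2)) * (K * fourier_norm G (b (n div 2)))"
        unfolding fourier_norm_uminus[OF mem(1)] by (intro mult_left_mono K mem fourier_norm_nonneg)
      then have "fourier_norm G (\<lambda>g. - 1 * a (n div 2) g) * fourier_norm G (\<lambda>g. b (n div 2) g * c g)
          \<le> K * ?N (n div 2)"
        by (simp only: mult_ac)
      moreover have "norm (fourier_norm G (a' n) * fourier_norm G (b' n))
          = fourier_norm G (\<lambda>g. - 1 * a (n div 2) g) * fourier_norm G (\<lambda>g. b (n div 2) g * c g)"
        unfolding a'_def b'_def using False fourier_norm_nonneg[OF neg] fourier_norm_nonneg[OF bc]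
        by (simp only: if_False real_norm_def abs_mult abs_of_nonneg)
      ultimately show ?thesis using False by (simp only: if_False)
    qed
    ultimately show "summable (\<lambda>n. fourier_norm G (a' n) * fourier_norm G (b' n))"
      by (rule summable_comparison_test'[where N = 0])
  qed
  then show "D \<in> proj_tensor (ZA G)" by (auto simp: proj_tensor_def)
  show "D (point_form g h) = (c g - c h) * u (point_form g h)" if gh: "g \<in> carrier G" "h \<in> carrier G"
  proof -
    note pb = point_form_bilinear[OF gh]
    have "(\<lambda>n. c g * (a n g * b n h)) sums u (\<lambda>x y. point_form g h (\<lambda>g. c g * x g) y)"
      using represents_ZA_sums[OF ab bounded_bilinear_forms_mult_left[OF pb c]] by
          (simp add: point_form_def mult.assoc)
    from sums_unique2[OF this sums_mult[OF tensor_point_sums[OF ab gh]]]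
    have l: "u (\<lambda>x y. point_form g h (\<lambda>g. c g * x g) y) = c g * u (point_form g h)" .
    have "(\<lambda>n. c h * (a n g * b n h)) sums u (\<lambda>x y. point_form g h x (\<lambda>g. y g * c g))"
      using represents_ZA_sums[OF ab bounded_bilinear_forms_mult_right[OF pb c]] by
          (simp add: point_form_def mult_ac)
    from sums_unique2[OF this sums_mult[OF tensor_point_sums[OF ab gh]]]
    have r: "u (\<lambda>x y. point_form g h x (\<lambda>g. y g * c g)) = c h * u (point_form g h)" .
    show ?thesis using pb by (simp add: D l r left_diff_distrib)
  qed
qed

section \<open>Limits along a bounded approximate diagonal\<close>

lemma approximate_diagonal_tensor:
  assumes "bounded_approximate_diagonal A F"
  shows "eventually (\<lambda>u. u \<in> proj_tensor A) F"
proof -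
  from assms obtain M where "F \<le> principal {u \<in> proj_tensor A. proj_norm A u \<le> M}"
    unfolding bounded_approximate_diagonal_def tensor_bounded_by_def by blast
  then have "eventually (\<lambda>u. u \<in> {u \<in> proj_tensor A. proj_norm A u \<le> M}) F" by (simp only: le_principal)
  then show ?thesis by (rule eventually_mono) simp
qed

text \<open>Class functions cannot separate conjugate points, so the value at the pair equals the value of
  the product of the tensor at \<open>g\<close>, and the product tends to the unit.\<close>

lemma approximate_diagonal_conjugate:
  assumes F: "bounded_approximate_diagonal (ZA G) F" and g: "g \<in> carrier G" and k: "k \<in> carrier G"
  shows "((\<lambda>u. u (point_form g (k \<otimes> g \<otimes> inv k))) \<longlongrightarrow> 1) F"
proof -
  define e where "e = (\<lambda>x. if x \<in> carrier G then 1 else 0 :: complex)"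
  have e: "e \<in> class_functions G" by (simp add: e_def class_functions_def)
  have lim: "((\<lambda>u. nrm (ZA G) ((mult_map (ZA G) u \<otimes>\<^bsub>ZA G\<^esub> e) \<ominus>\<^bsub>ZA G\<^esub> e)) \<longlongrightarrow> 0) F"
    using F e unfolding bounded_approximate_diagonal_def by (simp add: ZA_simps(1))
  have "((\<lambda>u. u (point_form g (k \<otimes> g \<otimes> inv k)) - 1) \<longlongrightarrow> 0) F"
  proof (rule tendsto_zero_comparison[OF _ lim])
    show "eventually (\<lambda>u. norm (u (point_form g (k \<otimes> g \<otimes> inv k)) - 1) \<le>
      nrm (ZA G) ((mult_map (ZA G) u \<otimes>\<^bsub>ZA G\<^esub> e) \<ominus>\<^bsub>ZA G\<^esub> e)) F"
      using approximate_diagonal_tensor[OF F]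
    proof (rule eventually_mono)
      fix u assume u: "u \<in> proj_tensor (ZA G)"
      let ?m = "mult_map (ZA G) u"
      have me: "(\<lambda>x. ?m x * e x) \<in> class_functions G" by (rule class_functions_mult[OF mult_map_ZA(2)[OF u] e])
      have "cmod (?m g * e g - e g) \<le> fourier_norm G (\<lambda>x. ?m x * e x - e x)"
        by (rule cmod_le_fourier_norm[OF class_functions_diff[OF me e] g])
      moreover have "?m g * e g - e g = u (point_form g (k \<otimes> g \<otimes> inv k)) - 1"
        using g by (simp add: e_def mult_map_ZA(1)[OF u] tensor_point_conjugate[OF u g k])
      ultimately show "norm (u (point_form g (k \<otimes> g \<otimes> inv k)) - 1)
          \<le> nrm (ZA G) ((?m \<otimes>\<^bsub>ZA G\<^esub> e) \<ominus>\<^bsub>ZA G\<^esub> e)"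
        by (simp only: ZA_simps(2,6) ZA_minus[OF me e])
    qed
  qed
  then show ?thesis by (rule LIM_zero_cancel)
qed

text \<open>A class function that separates \<open>g\<close> and \<open>h\<close> acts on the two sides with different values.\<close>

lemma approximate_diagonal_nonconjugate:
  assumes F: "bounded_approximate_diagonal (ZA G) F" and g: "g \<in> carrier G" and h: "h \<in> carrier G"
    and c: "c \<in> class_functions G" "c g \<noteq> c h"
  shows "((\<lambda>u. u (point_form g h)) \<longlongrightarrow> 0) F"
proof -
  let ?D = "\<lambda>u \<phi>. left_act (ZA G) c u \<phi> - right_act (ZA G) u c \<phi>"
  have lim: "((\<lambda>u. proj_norm (ZA G) (?D u)) \<longlongrightarrow> 0) F"
    using F c unfolding bounded_approximate_diagonal_def by (simp add: ZA_simps(1))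
  have "((\<lambda>u. (c g - c h) * u (point_form g h)) \<longlongrightarrow> 0) F"
  proof (rule tendsto_zero_comparison[OF _ lim])
    show "eventually (\<lambda>u. norm ((c g - c h) * u (point_form g h)) \<le> proj_norm (ZA G) (?D u)) F"
      using approximate_diagonal_tensor[OF F]
    proof (rule eventually_mono)
      fix u assume u: "u \<in> proj_tensor (ZA G)"
      have "cmod (?D u (point_form g h)) \<le> 1 * proj_norm (ZA G) (?D u)"
        by (rule proj_tensor_functional_bound[OF act_difference(1)[OF u c(1)] point_form_bilinear[OF g h]])
           (use point_form_bound[OF g h] in \<open>simp_all add: ZA_simps\<close>)
      then show "norm ((c g - c h) * u (point_form g h)) \<le> proj_norm (ZA G) (?D u)"
        by (simp only: act_difference(2)[OF u c(1) g h] mult_1)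
    qed
  qed
  from tendsto_mult_right_zero[OF this, of "inverse (c g - c h)"] show ?thesis
    using c(2) by (simp add: mult.assoc[symmetric])
qed

text \<open>The four points \<open>s\<^sub>i\<^sup>-\<^sup>1 t\<^sub>j\<close> are \<open>(1, 1)\<close>, \<open>(x\<^sup>-\<^sup>1, x\<^sup>-\<^sup>1)\<close>, \<open>(x, y)\<close>
    and \<open>(1, y x\<^sup>-\<^sup>1)\<close>. The first three
  are pairs of conjugate elements; the last is not, since only the unit is conjugate to the unit.\<close>

lemma approximate_diagonal_norm_ge:
  assumes F: "bounded_approximate_diagonal (ZA G) F" and M: "tensor_bounded_by (ZA G) F M"
    and x: "x \<in> carrier G" and k: "k \<in> carrier G" and nc: "k \<otimes> x \<noteq> x \<otimes> k"
  shows "M \<ge> 2 / sqrt 3"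
proof -
  define y where "y = k \<otimes> x \<otimes> inv k"
  have y: "y \<in> carrier G" using x k by (simp add: y_def)
  have yx: "y \<otimes> inv x \<noteq> \<one>"
  proof
    assume "y \<otimes> inv x = \<one>"
    moreover have "y = (y \<otimes> inv x) \<otimes> x" using x y by (simp add: m_assoc)
    ultimately have "y = x" using x by simp
    moreover have "k \<otimes> x = y \<otimes> k" unfolding y_def using x k by (simp add: m_assoc)
    ultimately show False using nc by simp
  qed
  define s1 s2 t1 t2 where "s1 = (\<one>, \<one>)" and "s2 = (inv x, inv y)" and "t1 = (\<one>, \<one>)" and "t2
      = (inv x, inv x)"
  have st: "s1 \<in> carrier G \<times> carrier G" "s2 \<in> carrier G \<times> carrier G"
    "t1 \<in> carrier G \<times> carrier G" "t2 \<in> carrier G \<times> carrier G"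
    using x y by (auto simp: s1_def s2_def t1_def t2_def)
  let ?T = "three_ones_form s1 s2 t1 t2"
  have lim1: "((\<lambda>u. u (point_form g g)) \<longlongrightarrow> 1) F" if "g \<in> carrier G" for g
    using approximate_diagonal_conjugate[OF F that one_closed] that by simp
  have lim2: "((\<lambda>u. u (point_form x y)) \<longlongrightarrow> 1) F"
    unfolding y_def by (rule approximate_diagonal_conjugate[OF F x k])
  have cl: "(\<lambda>z. if z = \<one> then 1 else 0) \<in> class_functions G"
  proof -
    have "h \<otimes> g \<otimes> inv h = \<one> \<longleftrightarrow> g = \<one>" if gh: "g \<in> carrier G" "h \<in> carrier G" for g h
    proof
      assume "h \<otimes> g \<otimes> inv h = \<one>"
      moreover have "h \<otimes> g = (h \<otimes> g \<otimes> inv h) \<otimes> h" using gh by (simp add: m_assoc)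
      ultimately have "h \<otimes> g = h" using gh by simp
      then show "g = \<one>" using gh by simp
    qed (use gh in simp)
    then show ?thesis unfolding class_functions_def using one_closed by auto
  qed
  have lim0: "((\<lambda>u. u (point_form \<one> (y \<otimes> inv x))) \<longlongrightarrow> 0) F"
    by (rule approximate_diagonal_nonconjugate[OF F _ _ cl]) (use x y yx in auto)
  define L where "L u = 2 * u (point_form \<one> \<one>) + 2 * u (point_form (inv x) (inv x))
      + 2 * u (point_form x y) - u (point_form \<one> (y \<otimes> inv x))" for u :: "('g \<Rightarrow> complex) tensor"
  have "(L \<longlongrightarrow> 2 * 1 + 2 * 1 + 2 * 1 - 0) F"
    unfolding L_def
    by (intro tendsto_diff tendsto_add tendsto_mult_left lim0 lim2 lim1 one_closed inv_closed x)
  then have lim: "((\<lambda>u. cmod (L u)) \<longlongrightarrow> cmod (2 * 1 + 2 * 1 + 2 * 1 - 0)) F"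
    by (rule tendsto_norm)
  have "cmod (L u) \<le> 3 * sqrt 3 * M" if u: "u \<in> {u \<in> proj_tensor (ZA G). proj_norm (ZA G) u \<le> M}" for u
  proof -
    have u1: "u \<in> proj_tensor (ZA G)" and u2: "proj_norm (ZA G) u \<le> M" using u by simp_all
    have LT: "L u = u ?T"
      unfolding tensor_three_ones[OF u1 st] L_def using x y by (simp add: s1_def s2_def t1_def t2_def)
    have "cmod (L u) \<le> 3 * sqrt 3 * proj_norm (ZA G) u"
      unfolding LT
    proof (rule proj_tensor_functional_bound[OF u1 three_ones_form_bilinear[OF st]])
      fix f h assume "f \<in> carrier (ZA G)" "h \<in> carrier (ZA G)"
      then show "cmod (?T f h) \<le> 3 * sqrt 3 * nrm (ZA G) f * nrm (ZA G) h"
        unfolding ZA_simps by (rule three_ones_form_bound[OF _ _ st])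
    qed simp
    also have "\<dots> \<le> 3 * sqrt 3 * M" by (rule mult_left_mono[OF u2]) simp
    finally show ?thesis .
  qed
  then have ev: "eventually (\<lambda>u. cmod (L u) \<le> 3 * sqrt 3 * M) F"
    using M[unfolded tensor_bounded_by_def le_principal] by (rule eventually_mono[rotated])
  have "F \<noteq> bot" using F by (simp add: bounded_approximate_diagonal_def)
  from tendsto_upperbound[OF lim ev this] have "cmod (2 * 1 + 2 * 1 + 2 * 1 - 0) \<le> 3 * sqrt 3 * M" .
  also have "3 * sqrt 3 * M = 3 * (M * sqrt 3)" by (simp only: mult_ac)
  finally have "2 \<le> M * sqrt 3" by simp
  moreover have "sqrt 3 > 0" by simp
  ultimately show ?thesis by (simp only: pos_divide_le_eq)
qed

end

theorem corollary4p3: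
  fixes G :: "('g, 'm) monoid_scheme"
  assumes "group G" and "finite (carrier G)" and "\<not> comm_group G"
  shows "amenability_constant (ZA G) \<ge> ereal (2 / sqrt 3)"
proof -
  interpret finite_group G
    using assms(1,2) by (simp add: finite_group_def finite_group_axioms_def)
  obtain x k where xk: "x \<in> carrier G" "k \<in> carrier G" "k \<otimes>\<^bsub>G\<^esub> x \<noteq> x \<otimes>\<^bsub>G\<^esub> k"
  proof (rule ccontr)
    note obtained = that
    assume no: "\<not> thesis"
    have "x \<otimes>\<^bsub>G\<^esub> y = y \<otimes>\<^bsub>G\<^esub> x" if xy: "x \<in> carrier G" "y \<in> carrier G" for x y
    proof (rule ccontr)
      assume "x \<otimes>\<^bsub>G\<^esub> y \<noteq> y \<otimes>\<^bsub>G\<^esub> x"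
      from no obtained[OF xy(2,1) this] show False by (rule notE)
    qed
    then have "comm_group G" by (rule group_comm_groupI)
    with assms(3) show False by (rule notE)
  qed
  show ?thesis
    unfolding amenability_constant_def
  proof (rule Inf_greatest)
    fix r assume "r \<in> {ereal M | M. M > 0 \<and>
      (\<exists>F. bounded_approximate_diagonal (ZA G) F \<and> tensor_bounded_by (ZA G) F M)}"
    then obtain M F where "r = ereal M" "bounded_approximate_diagonal (ZA G) F" "tensor_bounded_by (ZA G) F M"
      by blast
    with approximate_diagonal_norm_ge[OF _ _ xk] show "ereal (2 / sqrt 3) \<le> r" by simp
  qed
qed

end
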